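(* For all sufficiently large $n$, the threshold biases of the $(1:q)$ $K_4$-Game and of the $(1:q)$ Budget $K_4$-Game on $K_n$ satisfy $$q_{K_4}(n)\ge 6\cdot 10^{-6}\,n^{2/5}\qquad\text{and}\qquad q_{K_4}^b(n)\ge 6\cdot 10^{-6}\,n^{2/5}.$$
   Context: The $(1:q)$ $K_4$-Game on the complete graph $K_n$ is played by Maker and Breaker. In each round, Maker first claims one previously unclaimed edge of $K_n$, whereafter Breaker claims $q$ previously unclaimed edges of $K_n$ (unless fewer than $q$ unclaimed edges remain, in which case he claims all remaining edges). Maker wins if at some point she has claimed all six edges of a copy of $K_4$ in $K_n$. Breaker wins if he has claimed at least one edge of each copy of $K_4$ in $K_n$. The threshold bias $q_{K_4}(n)$ is the smallest non-negative integer $q$ such that Breaker has a winning strategy in this game. The $(1:q)$ Budget $K_4$-Game is the variant in which, in his turn, Breaker may instead claim an arbitrary number (possibly zero) of previously unclaimed edges of $K_n$, subject to the condition that at the end of his turn the total number of edges claimed by Breaker so far is at most $q$ times the total number of edges claimed by Maker so far; everything else is unchanged. Its threshold bias, the smallest non-negative integer $q$ such that Breaker has a winning strategy, is denoted $q_{K_4}^b(n)$. *)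

theory Defs
  imports Complex_Main "HOL-Library.Ramsey"
begin

text \<open>
  Maker-Breaker games on the edge set of the complete graph with vertex set \<open>{..<n}\<close>.
  Edges are two-element vertex sets, that is, elements of \<open>nsets {..<n} 2\<close>.
\<close>

type_synonym edge = "nat set"

abbreviation K_edges :: "nat \<Rightarrow> edge set" where
  "K_edges n \<equiv> nsets {..<n} 2"

definition K4_copies :: "nat \<Rightarrow> edge set set" where
  "K4_copies n = (\<lambda>S. nsets S 2) ` nsets {..<n} 4"

text \<open>
  A round consists of the edge claimed by Maker and the set of edges with which Breaker
  answers. A history is the list of the completed rounds, oldest first.
\<close>

type_synonym history = "(edge \<times> edge set) list"

definition maker_edges :: "history \<Rightarrow> edge set" where
  "maker_edges h = fst ` set h"

definition breaker_edges :: "history \<Rightarrow> edge set" where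
  "breaker_edges h = \<Union> (snd ` set h)"

definition unclaimed :: "nat \<Rightarrow> edge set \<Rightarrow> edge set \<Rightarrow> edge set" where
  "unclaimed n M B = K_edges n - (M \<union> B)"

text \<open>
  A rule says which answers \<open>C\<close> Breaker may give on his turn, where \<open>M\<close> is the set of Maker's
  edges (including the one just claimed) and \<open>B\<close> is the set of Breaker's edges before his turn.
\<close>

type_synonym rule = "edge set \<Rightarrow> edge set \<Rightarrow> edge set \<Rightarrow> bool"

definition biased_rule :: "nat \<Rightarrow> nat \<Rightarrow> rule" where
  "biased_rule n q M B C \<longleftrightarrow>
     C \<subseteq> unclaimed n M B \<and> card C = min q (card (unclaimed n M B))"

definition budget_rule :: "nat \<Rightarrow> nat \<Rightarrow> rule" where
  "budget_rule n q M B C \<longleftrightarrow>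
     C \<subseteq> unclaimed n M B \<and> card (B \<union> C) \<le> q * card M"

text \<open>
  A strategy of Breaker determines his answer from the history and the edge Maker has just claimed.
\<close>

type_synonym strategy = "history \<Rightarrow> edge \<Rightarrow> edge set"

inductive follows :: "nat \<Rightarrow> strategy \<Rightarrow> history \<Rightarrow> bool" for n s where
  start: "follows n s []"
| round: "follows n s h \<Longrightarrow> e \<in> unclaimed n (maker_edges h) (breaker_edges h)
    \<Longrightarrow> follows n s (h @ [(e, s h e)])"

definition legal_strategy :: "nat \<Rightarrow> rule \<Rightarrow> strategy \<Rightarrow> bool" where
  "legal_strategy n R s \<longleftrightarrow>
     (\<forall>h e. follows n s h \<and> e \<in> unclaimed n (maker_edges h) (breaker_edges h) \<longrightarrow>
        R (insert e (maker_edges h)) (breaker_edges h) (s h e))"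

definition finished :: "nat \<Rightarrow> history \<Rightarrow> bool" where
  "finished n h \<longleftrightarrow> unclaimed n (maker_edges h) (breaker_edges h) = {}"

definition breaker_wins :: "nat \<Rightarrow> history \<Rightarrow> bool" where
  "breaker_wins n h \<longleftrightarrow> (\<forall>K\<in>K4_copies n. K \<inter> breaker_edges h \<noteq> {})"

text \<open>
  Claimed edges are never released, so the winner can be read off when no unclaimed edge is left:
  if Maker owns a copy of \<open>K\<^sub>4\<close> at some point, then Breaker never gets an edge of it, and otherwise
  every copy finally contains an edge of Breaker.
\<close>

definition winning_strategy :: "nat \<Rightarrow> rule \<Rightarrow> strategy \<Rightarrow> bool" where
  "winning_strategy n R s \<longleftrightarrow>
     legal_strategy n R s \<and> (\<forall>h. follows n s h \<and> finished n h \<longrightarrow> breaker_wins n h)"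

text \<open>
  In both games Breaker wins if \<open>q\<close> is at least the number of edges, since he can then claim
  all remaining edges after Maker's first move. So the minima below are attained.
\<close>

definition q_K4 :: "nat \<Rightarrow> nat" where
  "q_K4 n = (LEAST q. \<exists>s. winning_strategy n (biased_rule n q) s)"

definition q_K4_budget :: "nat \<Rightarrow> nat" where
  "q_K4_budget n = (LEAST q. \<exists>s. winning_strategy n (budget_rule n q) s)"

end

theory Submission
  imports Defs
begin

text \<open>
  Maker derandomises the following play. Fix disjoint vertex classes \<open>U, V, X, Y\<close> of size \<open>L = t^5\<close>,
  where \<open>n\<close> is of order \<open>t^5\<close>. In five stages of \<open>t^8\<close> attempts each she tries uniformly random edges
  \<open>xy, ux, vx, uy, vy\<close>, skipping the edges that Breaker already owns; every edge of a stage is hit with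
  density \<open>p = 1/t^2\<close>. If \<open>q\<close> is a small multiple of \<open>t^2\<close>, then in both games Breaker owns at most
  \<open>b = 5 q t^8\<close> edges throughout, a small fraction of the \<open>t^10\<close> pairs \<open>uv\<close>. By a second moment
  estimate he hits few of the partial structures, so more than \<open>b\<close> pairs \<open>uv\<close> become the missing edge
  of a \<open>K\<^sub>4\<close>. One of them is not Breaker's, and Maker claims it.

  The number of such pairs is bounded from below by \<open>\<Sum> (A Y - (A Y / 2)\<^sup>2)\<close>, where \<open>Y\<close> counts the
  structures missing \<open>uv\<close>. This is linear minus quadratic in the outcome of each stage, so that
  the method of conditional expectations applies round by round.
\<close>

section \<open>Conditional expectations within a stage\<close>

text \<open>The intended \<open>N e\<close> is the number of hits of \<open>e\<close>, with
  repetition rather than mere ownership, so that the moments after uniform attempts are those of a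
  multinomial vector.\<close>

definition gain :: "'a set \<Rightarrow> ('a \<Rightarrow> real) \<Rightarrow> ('a \<Rightarrow> 'a \<Rightarrow> real) \<Rightarrow> ('a \<Rightarrow> real) \<Rightarrow> real" where
  "gain D w c N = (\<Sum>e\<in>D. w e * N e) - (\<Sum>e\<in>D. \<Sum>e'\<in>D. c e e' * (N e * N e'))"

text \<open>A lower bound for the expected gain after \<open>r\<close> further uniform attempts in \<open>D\<close>, if the edges
  of Breaker in \<open>D\<close> never have total weight above \<open>\<beta>\<close>.\<close>

definition prospect ::
    "nat \<Rightarrow> 'a set \<Rightarrow> ('a \<Rightarrow> real) \<Rightarrow> ('a \<Rightarrow> 'a \<Rightarrow> real) \<Rightarrow> real \<Rightarrow> ('a \<Rightarrow> real) \<Rightarrow> real" where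
  "prospect r D w c \<beta> N = gain D w c N
     + real r / real (card D) * (sum w D - \<beta>
         - (\<Sum>e\<in>D. (\<Sum>e'\<in>D. c e e' * N e') + (\<Sum>e'\<in>D. c e' e * N e') + c e e))
     - real r * (real r - 1) / (real (card D))\<^sup>2 * (\<Sum>e\<in>D. \<Sum>e'\<in>D. c e e')"

lemma gain_add_one:
  assumes "finite D" "x \<in> D"
  shows "gain D w c (\<lambda>e. N e + (if e = x then 1 else 0)) = gain D w c N + w x
    - ((\<Sum>e\<in>D. c x e * N e) + (\<Sum>e\<in>D. c e x * N e) + c x x)"
  using assms unfolding gain_def
  by (simp add: algebra_simps sum.distrib if_distrib[of "\<lambda>t. _ * t"] cong: if_cong)
    (subst sum.swap, simp)

lemma prospect_add_one:
  assumes "finite D" "x \<in> D"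
  shows "prospect r D w c \<beta> (\<lambda>e. N e + (if e = x then 1 else 0)) = prospect r D w c \<beta> N + w x
    - ((\<Sum>e\<in>D. c x e * N e) + (\<Sum>e\<in>D. c e x * N e) + c x x)
    - real r / real (card D) * ((\<Sum>e\<in>D. c e x) + (\<Sum>e\<in>D. c x e))"
proof -
  have 1: "(\<Sum>e'\<in>D. c e e' * (N e' + (if e' = x then 1 else 0))) = (\<Sum>e'\<in>D. c e e' * N e') + c e x"
    and 2: "(\<Sum>e'\<in>D. c e' e * (N e' + (if e' = x then 1 else 0))) = (\<Sum>e'\<in>D. c e' e * N e') + c x e"
    for e
    using assms by (simp_all add: algebra_simps sum.distrib if_distrib[of "\<lambda>t. _ * t"] cong: if_cong)
  show ?thesis
    unfolding prospect_def gain_add_one[OF assms] 1 2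
    by (simp add: sum.distrib algebra_simps)
qed

text \<open>Average over a uniform \<open>x\<close> in \<open>D\<close>, an edge of \<open>B\<close>
  meaning a wasted attempt. The mean of the next prospect is at least the present one, so some
  outcome reaches it; the first alternative is the wasted attempt.\<close>

lemma exists_good_edge:
  assumes "finite D" "D \<noteq> {}" and c: "\<And>e e'. c e e' \<ge> 0" and N: "\<And>e. N e \<ge> 0"
    and \<beta>: "sum w (D \<inter> B) \<le> \<beta>"
  shows "prospect (Suc r) D w c \<beta> N \<le> prospect r D w c \<beta> N \<or>
    (\<exists>x\<in>D - B. prospect (Suc r) D w c \<beta> N
       \<le> prospect r D w c \<beta> (\<lambda>e. N e + (if e = x then 1 else 0)))"
proof (rule ccontr)
  assume neg: "\<not> ?thesis"
  define d where "d = real (card D)"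
  have d: "d > 0" using assms by (simp add: d_def card_gt_0_iff)
  define cross where "cross x = (\<Sum>e\<in>D. c x e * N e) + (\<Sum>e\<in>D. c e x * N e) + c x x" for x
  define deg where "deg x = (\<Sum>e\<in>D. c e x) + (\<Sum>e\<in>D. c x e)" for x
  have nonneg: "cross x \<ge> 0" "deg x \<ge> 0" for x
    using c N by (auto simp: cross_def deg_def intro!: add_nonneg_nonneg sum_nonneg)
  define \<Delta> where "\<Delta> = prospect (Suc r) D w c \<beta> N - prospect r D w c \<beta> N"
  define \<delta> where "\<delta> x = w x - cross x - real r / d * deg x" for x
  have deg_sum: "(\<Sum>x\<in>D. deg x) = 2 * (\<Sum>e\<in>D. \<Sum>e'\<in>D. c e e')"
  proof -
    have "(\<Sum>x\<in>D. \<Sum>e\<in>D. c e x) = (\<Sum>e\<in>D. \<Sum>e'\<in>D. c e e')" by (rule sum.swap)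
    thus ?thesis unfolding deg_def sum.distrib by simp
  qed
  have cross_sum: "(\<Sum>e\<in>D. (\<Sum>e'\<in>D. c e e' * N e') + (\<Sum>e'\<in>D. c e' e * N e') + c e e) = (\<Sum>x\<in>D. cross x)"
    by (simp add: cross_def)
  \<comment> \<open>The factors \<open>r * (r - 1)\<close> of consecutive prospects differ by
    \<open>2 * r\<close>; the 2 is absorbed by \<open>deg_sum\<close>.\<close>
  have "\<Delta> * d = sum w D - \<beta> - (\<Sum>x\<in>D. cross x) - real r / d * (\<Sum>x\<in>D. deg x)"
    unfolding \<Delta>_def prospect_def cross_sum deg_sum d_def[symmetric]
    using d by (simp add: field_simps power2_eq_square)
  also have "sum w D = sum w (D - B) + sum w (D \<inter> B)"
    using sum.Int_Diff[OF \<open>finite D\<close>, of w B] by simp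
  \<comment> \<open>Leaving out Breaker's edges costs weight at most \<open>\<beta>\<close>. In the
    subtracted sums it only helps, since \<open>cross\<close> and \<open>deg\<close> are
    nonnegative.\<close>
  also have "\<dots> - \<beta> - (\<Sum>x\<in>D. cross x) - real r / d * (\<Sum>x\<in>D. deg x)
    \<le> sum w (D - B) - (\<Sum>x\<in>D-B. cross x) - real r / d * (\<Sum>x\<in>D-B. deg x)"
  proof -
    have "(\<Sum>x\<in>D-B. cross x) \<le> (\<Sum>x\<in>D. cross x)"
      using assms(1) nonneg by (intro sum_mono2) auto
    moreover have "real r / d * (\<Sum>x\<in>D-B. deg x) \<le> real r / d * (\<Sum>x\<in>D. deg x)"
      using assms(1) nonneg d by (intro mult_left_mono sum_mono2) auto
    ultimately show ?thesis using \<beta> by simp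
  qed
  also have "\<dots> = (\<Sum>x\<in>D-B. \<delta> x)"
    by (simp add: \<delta>_def sum_subtractf sum_distrib_left)
  \<comment> \<open>A wasted attempt changes nothing, hence the value 0 on \<open>B\<close>; the
    negated first alternative says that 0 is below \<open>\<Delta>\<close>.\<close>
  also have "\<dots> = (\<Sum>x\<in>D. if x \<in> B then 0 else \<delta> x)"
    using assms(1) by (intro sum.mono_neutral_cong_left) auto
  also have "\<dots> < (\<Sum>x\<in>D. \<Delta>)"
  proof (rule sum_strict_mono)
    fix x assume x: "x \<in> D"
    show "(if x \<in> B then 0 else \<delta> x) < \<Delta>"
    proof (cases "x \<in> B")
      case True
      thus ?thesis using neg by (simp add: \<Delta>_def)
    next
      case False
      with neg x have "\<not> prospect (Suc r) D w c \<beta> N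
          \<le> prospect r D w c \<beta> (\<lambda>e. N e + (if e = x then 1 else 0))" by blast
      thus ?thesis
        using prospect_add_one[OF assms(1) x, of r w c \<beta> N] False
        by (simp add: \<Delta>_def \<delta>_def cross_def deg_def d_def)
    qed
  qed (use assms in auto)
  finally show False by (simp add: d_def mult.commute)
qed

text \<open>The square of a fibre sum is a sum over pairs in the fibre. This turns the squared
  weight of an edge, and later the squared count at a missing edge, into a sum over pairs of
  structures.\<close>

lemma sum_square_fibres:
  fixes f :: "'a \<Rightarrow> real"
  assumes "finite S" "finite D" "\<epsilon> ` S \<subseteq> D"
  shows "(\<Sum>e\<in>D. (\<Sum>\<phi> | \<phi> \<in> S \<and> \<epsilon> \<phi> = e. f \<phi>)\<^sup>2)
    = (\<Sum>z\<in>S\<times>S. if \<epsilon> (fst z) = \<epsilon> (snd z) then f (fst z) * f (snd z) else 0)"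
proof -
  define w where "w e = (\<Sum>\<phi> | \<phi> \<in> S \<and> \<epsilon> \<phi> = e. f \<phi>)" for e
  have "(\<Sum>\<phi>\<in>S. f \<phi> * w (\<epsilon> \<phi>)) = (\<Sum>e\<in>D. \<Sum>\<phi> | \<phi> \<in> S \<and> \<epsilon> \<phi> = e. f \<phi> * w (\<epsilon> \<phi>))"
    by (rule sum.group[symmetric]) (use assms in auto)
  also have "\<dots> = (\<Sum>e\<in>D. (w e)\<^sup>2)"
    by (auto simp: w_def power2_eq_square sum_distrib_right intro!: sum.cong)
  finally have "(\<Sum>e\<in>D. (w e)\<^sup>2) = (\<Sum>\<phi>\<in>S. f \<phi> * w (\<epsilon> \<phi>))" ..
  also have "\<dots> = (\<Sum>\<phi>\<in>S. \<Sum>\<phi>'\<in>S. if \<epsilon> \<phi> = \<epsilon> \<phi>' then f \<phi> * f \<phi>' else 0)"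
    using assms by (auto simp: w_def sum_distrib_left sum.If_cases Int_def eq_commute intro!: sum.cong)
  finally show ?thesis by (simp add: w_def sum.cartesian_product split_def)
qed

section \<open>Play against a fixed strategy of Breaker\<close>

lemma maker_edges_Nil [simp]: "maker_edges [] = {}"
  and maker_edges_append [simp]: "maker_edges (h @ h') = maker_edges h \<union> maker_edges h'"
  and maker_edges_single [simp]: "maker_edges [(e, C)] = {e}"
  and breaker_edges_Nil [simp]: "breaker_edges [] = {}"
  and breaker_edges_append [simp]: "breaker_edges (h @ h') = breaker_edges h \<union> breaker_edges h'"
  and breaker_edges_single [simp]: "breaker_edges [(e, C)] = C"
  by (auto simp: maker_edges_def breaker_edges_def)

lemma finite_K_edges [simp]: "finite (K_edges n)"
  by (simp add: finite_imp_finite_nsets)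

lemma card_maker_edges_le: "card (maker_edges h) \<le> length h"
  unfolding maker_edges_def by (metis card_length length_map set_map)

text \<open>Isolates what both games have in common. The budget is counted in rounds and required
  only if it was kept before, since the biased rule bounds a single answer and the budget rule the
  total.\<close>

locale breaker_play =
  fixes n q :: nat and s :: strategy
  assumes answer_unclaimed:
    "follows n s h \<Longrightarrow> e \<in> unclaimed n (maker_edges h) (breaker_edges h) \<Longrightarrow>
       s h e \<subseteq> unclaimed n (insert e (maker_edges h)) (breaker_edges h)"
  and answer_budget:
    "follows n s h \<Longrightarrow> e \<in> unclaimed n (maker_edges h) (breaker_edges h) \<Longrightarrow>
       card (breaker_edges h) \<le> q * length h \<Longrightarrow>
       card (breaker_edges h \<union> s h e) \<le> q * Suc (length h)"
begin

lemma follows_invariants: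
  assumes "follows n s h"
  shows "maker_edges h \<subseteq> K_edges n" "breaker_edges h \<subseteq> K_edges n"
    "maker_edges h \<inter> breaker_edges h = {}" "card (breaker_edges h) \<le> q * length h"
proof -
  have "maker_edges h \<subseteq> K_edges n \<and> breaker_edges h \<subseteq> K_edges n \<and>
    maker_edges h \<inter> breaker_edges h = {} \<and> card (breaker_edges h) \<le> q * length h"
    using assms
  proof induction
    case (round h e)
    with answer_unclaimed[of h e] answer_budget[of h e] show ?case
      by (auto simp: unclaimed_def)
  qed simp
  thus "maker_edges h \<subseteq> K_edges n" "breaker_edges h \<subseteq> K_edges n"
    "maker_edges h \<inter> breaker_edges h = {}" "card (breaker_edges h) \<le> q * length h" by auto
qed

lemma claim_edge:
  assumes "follows n s h" "e \<in> K_edges n" "e \<notin> breaker_edges h"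
  obtains h' where "follows n s h'" "length h' \<le> Suc (length h)"
    "maker_edges h' = insert e (maker_edges h)"
proof (cases "e \<in> maker_edges h")
  case True
  with assms(1) that[of h] show ?thesis by auto
next
  case False
  with assms have "e \<in> unclaimed n (maker_edges h) (breaker_edges h)"
    by (auto simp: unclaimed_def)
  from follows.round[OF assms(1) this] that show ?thesis by force
qed

text \<open>The winner is read off finished histories only, so a position containing Maker's
  \<open>K4\<close> must be played to the end. Any free edge will do for Maker, and each round uses
  up at least that edge.\<close>

lemma finish_game:
  assumes "follows n s h"
  shows "\<exists>h'. follows n s h' \<and> finished n h' \<and> maker_edges h \<subseteq> maker_edges h'"
  using assms
proof (induction "card (unclaimed n (maker_edges h) (breaker_edges h))" arbitrary: h
    rule: less_induct)
  case less
  show ?case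
  proof (cases "finished n h")
    case True
    with less.prems show ?thesis by blast
  next
    case False
    then obtain e where e: "e \<in> unclaimed n (maker_edges h) (breaker_edges h)"
      by (auto simp: finished_def)
    define h1 where "h1 = h @ [(e, s h e)]"
    have h1: "follows n s h1" unfolding h1_def by (rule follows.round[OF less.prems e])
    have "unclaimed n (maker_edges h1) (breaker_edges h1)
        \<subset> unclaimed n (maker_edges h) (breaker_edges h)"
      using e by (auto simp: h1_def unclaimed_def)
    hence "card (unclaimed n (maker_edges h1) (breaker_edges h1))
        < card (unclaimed n (maker_edges h) (breaker_edges h))"
      by (intro psubset_card_mono) (auto simp: unclaimed_def)
    from less.hyps[OF this h1] show ?thesis by (auto simp: h1_def)
  qed
qed

text \<open>Maker makes no move when the chosen edge is Breaker's or already her own; hence the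
  inequality for the length.\<close>

lemma stage:
  assumes "follows n s h" "D \<subseteq> K_edges n" "D \<noteq> {}"
    and c: "\<And>e e'. c e e' \<ge> 0" and "\<And>e. N e \<ge> 0" and "{e\<in>D. N e \<noteq> 0} \<subseteq> maker_edges h"
    and \<beta>: "\<And>B. finite B \<Longrightarrow> card B \<le> b \<Longrightarrow> sum w (D \<inter> B) \<le> \<beta>"
    and "q * (length h + r) \<le> b"
  shows "\<exists>h' N'. follows n s h' \<and> length h' \<le> length h + r \<and> maker_edges h \<subseteq> maker_edges h' \<and>
    (\<forall>e. N' e \<ge> 0) \<and> {e\<in>D. N' e \<noteq> 0} \<subseteq> maker_edges h' \<and>
    prospect r D w c \<beta> N \<le> gain D w c N'"
  using assms(1,5,6,8)
proof (induction r arbitrary: h N)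
  case 0
  then show ?case by (intro exI[of _ h] exI[of _ N]) (auto simp: prospect_def)
next
  case (Suc r)
  have "finite D" using assms(2) finite_K_edges by (rule finite_subset)
  have "card (breaker_edges h) \<le> q * length h" "finite (breaker_edges h)"
    using follows_invariants[OF Suc.prems(1)] finite_subset[OF _ finite_K_edges] by blast+
  moreover have "q * length h \<le> q * (length h + Suc r)" by (intro mult_left_mono) auto
  ultimately have \<beta>': "sum w (D \<inter> breaker_edges h) \<le> \<beta>"
    using \<beta> Suc.prems(4) by (meson order_trans)
  from exists_good_edge[where c = c and N = N, OF \<open>finite D\<close> assms(3) c Suc.prems(2) \<beta>', of r]
  show ?case
  proof (elim disjE bexE)
    \<comment> \<open>Maker skips this attempt: the history stays and \<open>r\<close> drops by
      one.\<close>
    assume *: "prospect (Suc r) D w c \<beta> N \<le> prospect r D w c \<beta> N"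
    have "q * (length h + r) \<le> b"
      using Suc.prems(4) by (auto simp: algebra_simps)
    from Suc.IH[OF Suc.prems(1-3) this] * show ?thesis by (auto intro: order_trans le_SucI)
  next
    fix x assume x: "x \<in> D - breaker_edges h"
    let ?N = "\<lambda>e. N e + (if e = x then 1 else 0)"
    assume *: "prospect (Suc r) D w c \<beta> N \<le> prospect r D w c \<beta> ?N"
    from x assms(2) have "x \<in> K_edges n" "x \<notin> breaker_edges h" by auto
    from claim_edge[OF Suc.prems(1) this] obtain h1 where h1: "follows n s h1"
      "length h1 \<le> Suc (length h)" "maker_edges h1 = insert x (maker_edges h)" .
    have "q * (length h1 + r) \<le> q * (length h + Suc r)" using h1(2) by (intro mult_left_mono) auto
    with Suc.prems(4) have "q * (length h1 + r) \<le> b" by linarith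
    moreover have "{e\<in>D. ?N e \<noteq> 0} \<subseteq> maker_edges h1" using Suc.prems(3) h1(3) by auto
    moreover have "?N e \<ge> 0" for e using Suc.prems(2)[of e] by simp
    ultimately obtain h' N' where "follows n s h'" "length h' \<le> length h1 + r"
      "maker_edges h1 \<subseteq> maker_edges h'" "\<forall>e. N' e \<ge> 0" "{e\<in>D. N' e \<noteq> 0} \<subseteq> maker_edges h'"
      "prospect r D w c \<beta> ?N \<le> gain D w c N'"
      using Suc.IH[OF h1(1), of ?N] by blast
    with h1 * show ?thesis by (intro exI[of _ h'] exI[of _ N']) auto
  qed
qed

text \<open>The random model behind this bound: every \<open>N e\<close> counts the successful ones among \<open>k\<close>
  independent uniform attempts in \<open>D\<close>, so that \<open>N e\<close> has mean at most \<open>p\<close>, and \<open>N e * N e'\<close> has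
  mean at most \<open>p\<^sup>2\<close>, plus \<open>p\<close> if \<open>e = e'\<close>.\<close>

lemma stage_structures:
  assumes h: "follows n s h" and D: "D \<subseteq> K_edges n" "D \<noteq> {}"
    and S: "finite S" "\<epsilon> ` S \<subseteq> D"
    and f: "\<And>\<phi>. f \<phi> \<ge> 0" and g: "\<And>\<phi> \<phi>'. g \<phi> \<phi>' \<ge> 0" and a: "a > 0"
    and b: "q * (length h + k) \<le> b" and p: "p = real k / real (card D)"
  shows "\<exists>h' N. follows n s h' \<and> length h' \<le> length h + k \<and> maker_edges h \<subseteq> maker_edges h' \<and>
    (\<forall>e. N e \<ge> 0) \<and> {e\<in>D. N e \<noteq> 0} \<subseteq> maker_edges h' \<and>
    p * (\<Sum>\<phi>\<in>S. f \<phi>)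
      - p * (a * real b
          + (\<Sum>z\<in>S\<times>S. if \<epsilon> (fst z) = \<epsilon> (snd z) then f (fst z) * f (snd z) else 0) / (4 * a))
      - (\<Sum>z\<in>S\<times>S. g (fst z) (snd z) * (p\<^sup>2 + (if \<epsilon> (fst z) = \<epsilon> (snd z) then p else 0)))
    \<le> (\<Sum>\<phi>\<in>S. f \<phi> * N (\<epsilon> \<phi>))
      - (\<Sum>z\<in>S\<times>S. g (fst z) (snd z) * (N (\<epsilon> (fst z)) * N (\<epsilon> (snd z))))"
proof -
  have fin: "finite D" using D(1) finite_K_edges by (rule finite_subset)
  \<comment> \<open>Weights of structures and of pairs of structures are collected on the edges used
    in this stage; \<open>group1\<close> and \<open>group2\<close> translate between the two
    descriptions.\<close>
  define w where "w e = (\<Sum>\<phi> | \<phi> \<in> S \<and> \<epsilon> \<phi> = e. f \<phi>)" for e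
  define c where "c e e' = (\<Sum>\<phi> | \<phi> \<in> S \<and> \<epsilon> \<phi> = e. \<Sum>\<phi>' | \<phi>' \<in> S \<and> \<epsilon> \<phi>' = e'. g \<phi> \<phi>')" for e e'
  have group1: "(\<Sum>e\<in>D. w e * H e) = (\<Sum>\<phi>\<in>S. f \<phi> * H (\<epsilon> \<phi>))" for H :: "edge \<Rightarrow> real"
  proof -
    have "(\<Sum>\<phi>\<in>S. f \<phi> * H (\<epsilon> \<phi>)) = (\<Sum>e\<in>D. \<Sum>\<phi> | \<phi> \<in> S \<and> \<epsilon> \<phi> = e. f \<phi> * H (\<epsilon> \<phi>))"
      by (rule sum.group[symmetric]) (use S fin in auto)
    thus ?thesis by (auto simp: w_def sum_distrib_right intro!: sum.cong)
  qed
  have group2: "(\<Sum>e\<in>D. \<Sum>e'\<in>D. c e e' * H e e')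
      = (\<Sum>z\<in>S\<times>S. g (fst z) (snd z) * H (\<epsilon> (fst z)) (\<epsilon> (snd z)))" for H :: "edge \<Rightarrow> edge \<Rightarrow> real"
  proof -
    have "(\<Sum>e'\<in>D. c e e' * H e e')
      = (\<Sum>\<phi> | \<phi> \<in> S \<and> \<epsilon> \<phi> = e. \<Sum>\<phi>'\<in>S. g \<phi> \<phi>' * H (\<epsilon> \<phi>) (\<epsilon> \<phi>'))" for e
    proof -
      have "(\<Sum>\<phi>'\<in>S. g \<phi> \<phi>' * H e (\<epsilon> \<phi>'))
        = (\<Sum>e'\<in>D. \<Sum>\<phi>' | \<phi>' \<in> S \<and> \<epsilon> \<phi>' = e'. g \<phi> \<phi>' * H e (\<epsilon> \<phi>'))" for \<phi>
        by (rule sum.group[symmetric]) (use S fin in auto)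
      hence "(\<Sum>\<phi> | \<phi> \<in> S \<and> \<epsilon> \<phi> = e. \<Sum>\<phi>'\<in>S. g \<phi> \<phi>' * H (\<epsilon> \<phi>) (\<epsilon> \<phi>'))
        = (\<Sum>\<phi> | \<phi> \<in> S \<and> \<epsilon> \<phi> = e. \<Sum>e'\<in>D. \<Sum>\<phi>' | \<phi>' \<in> S \<and> \<epsilon> \<phi>' = e'. g \<phi> \<phi>' * H e e')"
        by (auto intro!: sum.cong)
      also have "\<dots> = (\<Sum>e'\<in>D. \<Sum>\<phi> | \<phi> \<in> S \<and> \<epsilon> \<phi> = e. \<Sum>\<phi>' | \<phi>' \<in> S \<and> \<epsilon> \<phi>' = e'. g \<phi> \<phi>' * H e e')"
        by (rule sum.swap)
      finally show ?thesis by (simp add: c_def sum_distrib_right)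
    qed
    moreover have "(\<Sum>\<phi>\<in>S. \<Sum>\<phi>'\<in>S. g \<phi> \<phi>' * H (\<epsilon> \<phi>) (\<epsilon> \<phi>'))
      = (\<Sum>e\<in>D. \<Sum>\<phi> | \<phi> \<in> S \<and> \<epsilon> \<phi> = e. \<Sum>\<phi>'\<in>S. g \<phi> \<phi>' * H (\<epsilon> \<phi>) (\<epsilon> \<phi>'))"
      by (rule sum.group[symmetric]) (use S fin in auto)
    ultimately show ?thesis by (simp add: sum.cartesian_product split_def)
  qed
  have w_sq: "(\<Sum>e\<in>D. (w e)\<^sup>2)
      = (\<Sum>z\<in>S\<times>S. if \<epsilon> (fst z) = \<epsilon> (snd z) then f (fst z) * f (snd z) else 0)" (is "_ = ?Q")
    unfolding w_def by (rule sum_square_fibres[OF S(1) fin S(2)])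
  define \<beta> where "\<beta> = a * real b + ?Q / (4 * a)"
  have w: "w e \<ge> 0" for e using f by (auto simp: w_def intro: sum_nonneg)
  have c: "c e e' \<ge> 0" for e e' using g by (auto simp: c_def intro!: sum_nonneg)
  have loss: "sum w (D \<inter> B) \<le> \<beta>" if B: "finite B" "card B \<le> b" for B
  proof -
    \<comment> \<open>Breaker could pick the heaviest edges. This bound splits his damage into a
      cost \<open>a\<close> per edge and a second moment, so no maximum weight has to be
      controlled.\<close>
    have "w e \<le> a + (w e)\<^sup>2 / (4 * a)" for e
    proof -
      have "0 \<le> (w e - 2 * a)\<^sup>2" by simp
      thus ?thesis using a by (simp add: field_simps power2_eq_square)
    qed
    hence "sum w (D \<inter> B) \<le> (\<Sum>e\<in>D\<inter>B. a + (w e)\<^sup>2 / (4 * a))" by (rule sum_mono)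
    also have "\<dots> = a * real (card (D \<inter> B)) + (\<Sum>e\<in>D\<inter>B. (w e)\<^sup>2) / (4 * a)"
      by (simp add: sum.distrib sum_divide_distrib)
    also have "\<dots> \<le> \<beta>"
    proof -
      have "card (D \<inter> B) \<le> b" using card_mono[OF B(1), of "D \<inter> B"] B(2) by auto
      moreover have "(\<Sum>e\<in>D\<inter>B. (w e)\<^sup>2) \<le> ?Q" unfolding w_sq[symmetric]
        by (rule sum_mono2) (use fin in auto)
      ultimately show ?thesis unfolding \<beta>_def using a
        by (intro add_mono mult_left_mono divide_right_mono) auto
    qed
    finally show ?thesis .
  qed
  obtain h' N where *: "follows n s h'" "length h' \<le> length h + k" "maker_edges h \<subseteq> maker_edges h'"
      "\<forall>e. N e \<ge> 0" "{e\<in>D. N e \<noteq> 0} \<subseteq> maker_edges h'"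
      "prospect k D w c \<beta> (\<lambda>_. 0) \<le> gain D w c N"
    using stage[where c = c and N = "\<lambda>_. 0", OF h D c _ _ loss b] by auto
  have d: "card D > 0" using D fin by (simp add: card_gt_0_iff)
  have "p * sum f S - p * \<beta> - (\<Sum>e\<in>D. \<Sum>e'\<in>D. c e e' * (p\<^sup>2 + (if e = e' then p else 0)))
    = p * sum w D - p * \<beta> - p * (\<Sum>e\<in>D. c e e) - p\<^sup>2 * (\<Sum>e\<in>D. \<Sum>e'\<in>D. c e e')"
  proof -
    have "(\<Sum>e'\<in>D. c e e' * (p\<^sup>2 + (if e = e' then p else 0))) = p\<^sup>2 * (\<Sum>e'\<in>D. c e e') + p * c e e"
      if "e \<in> D" for e
      unfolding distrib_left sum.distrib sum_distrib_right[symmetric]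
      using fin that by (simp add: if_distrib[of "\<lambda>t. _ * t"] mult.commute cong: if_cong)
    thus ?thesis using group1[of "\<lambda>_. 1"] by (simp add: sum.distrib flip: sum_distrib_left)
  qed
  also have "\<dots> \<le> prospect k D w c \<beta> (\<lambda>_. 0)"
  proof -
    \<comment> \<open>Relaxing the exact factor to \<open>p\<^sup>2\<close> only lowers the bound,
      and it keeps the pair weights of different stages in product form.\<close>
    have "real k * (real k - 1) / (real (card D))\<^sup>2 \<le> p\<^sup>2"
      unfolding p power_divide by (intro divide_right_mono) (auto simp: power2_eq_square algebra_simps)
    hence "real k * (real k - 1) / (real (card D))\<^sup>2 * (\<Sum>e\<in>D. \<Sum>e'\<in>D. c e e')
        \<le> p\<^sup>2 * (\<Sum>e\<in>D. \<Sum>e'\<in>D. c e e')"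
      using c by (intro mult_right_mono sum_nonneg) auto
    thus ?thesis unfolding prospect_def gain_def p[symmetric] by (simp add: algebra_simps)
  qed
  also have "\<dots> \<le> gain D w c N" by (rule *(6))
  finally have "p * sum f S - p * \<beta> - (\<Sum>e\<in>D. \<Sum>e'\<in>D. c e e' * (p\<^sup>2 + (if e = e' then p else 0)))
      \<le> gain D w c N" .
  with * show ?thesis unfolding gain_def group1 group2 \<beta>_def by blast
qed

end

section \<open>Successive stages\<close>

text \<open>\<open>S\<close> is the set of potential structures; \<open>\<epsilon> i \<phi>\<close> is the edge of \<open>\<phi>\<close> played in stage \<open>i\<close> and \<open>\<rho> \<phi>\<close> its
  missing edge. The numbers \<open>a l\<close> are the scales in the bound \<open>w \<le> a l + w\<^sup>2 / (4 * a l)\<close> for the weights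
  that Breaker can destroy in stage \<open>l\<close>.\<close>

locale staged_play = breaker_play +
  fixes S :: "'s set" and \<epsilon> :: "nat \<Rightarrow> 's \<Rightarrow> edge" and \<rho> :: "'s \<Rightarrow> edge" and D :: "nat \<Rightarrow> edge set"
    and J k b :: nat and p A :: real and a :: "nat \<Rightarrow> real"
  assumes finite_S: "finite S" and \<epsilon>_D: "i < J \<Longrightarrow> \<epsilon> i ` S \<subseteq> D i"
    and D_edges: "i < J \<Longrightarrow> D i \<subseteq> K_edges n" and D_ne: "i < J \<Longrightarrow> D i \<noteq> {}"
    and p_eq: "i < J \<Longrightarrow> p = real k / real (card (D i))"
    and budget: "q * (J * k) \<le> b" and A_pos: "A > 0" and p_pos: "p > 0"
    and a_pos: "a i > 0"
begin

text \<open>In the next definitions the stages below \<open>j\<close> have been played with outcome \<open>N\<close>, and the later ones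
  are replaced by their expectations.\<close>

definition mean :: "nat \<Rightarrow> (nat \<Rightarrow> edge \<Rightarrow> real) \<Rightarrow> 's \<Rightarrow> real" where
  "mean j N \<phi> = (\<Prod>i<J. if i < j then N i (\<epsilon> i \<phi>) else p)"

definition pair_weight :: "nat \<Rightarrow> (nat \<Rightarrow> edge \<Rightarrow> real) \<Rightarrow> nat \<Rightarrow> 's \<Rightarrow> 's \<Rightarrow> real" where
  "pair_weight j N i \<phi> \<phi>' = (if i < j then N i (\<epsilon> i \<phi>) * N i (\<epsilon> i \<phi>')
     else p\<^sup>2 + (if \<epsilon> i \<phi> = \<epsilon> i \<phi>' then p else 0))"

definition second_moment :: "nat \<Rightarrow> ('s \<Rightarrow> edge) \<Rightarrow> nat \<Rightarrow> (nat \<Rightarrow> edge \<Rightarrow> real) \<Rightarrow> real" where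
  "second_moment m r j N = (\<Sum>z\<in>S\<times>S. if r (fst z) = r (snd z)
     then \<Prod>i<m. pair_weight j N i (fst z) (snd z) else 0)"

text \<open>Expected value of the sum of \<open>A * Y - (A / 2 * Y)\<^sup>2\<close> over the missing
  edges, less the damage still to come. The factor \<open>p ^ (J - l)\<close> is the chance that
  what is lost in stage \<open>l\<close> would have been completed. Damage in stages before
  \<open>j\<close> is already visible in \<open>N\<close>.\<close>

definition potential :: "nat \<Rightarrow> (nat \<Rightarrow> edge \<Rightarrow> real) \<Rightarrow> real" where
  "potential j N = A * (\<Sum>\<phi>\<in>S. mean j N \<phi>)
     - A * (\<Sum>l\<in>{j..<J}. p ^ (J - l) * (a l * real b + second_moment l (\<epsilon> l) j N / (4 * a l)))
     - (A / 2)\<^sup>2 * second_moment J \<rho> j N"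

lemma pair_weight_nonneg: "(\<And>i e. N i e \<ge> 0) \<Longrightarrow> pair_weight j N i \<phi> \<phi>' \<ge> 0"
  using p_pos by (simp add: pair_weight_def)

text \<open>With the earlier outcomes fixed, \<open>potential\<close> is linear minus quadratic in
  the outcome of stage \<open>j\<close>, so \<open>stage_structures\<close> applies. The loss term
  \<open>l = j\<close> is the damage in this stage; the later loss terms and the final second moment
  form the quadratic cost \<open>g\<close>.\<close>

lemma next_stage:
  assumes h: "follows n s h" "length h \<le> j * k" and j: "j < J" and N: "\<And>i e. N i e \<ge> 0"
  shows "\<exists>h' M. follows n s h' \<and> length h' \<le> Suc j * k \<and> maker_edges h \<subseteq> maker_edges h' \<and>
    (\<forall>e. M e \<ge> 0) \<and> {e\<in>D j. M e \<noteq> 0} \<subseteq> maker_edges h' \<and>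
    potential j N \<le> potential (Suc j) (N(j := M))"
proof -
  define f0 where "f0 \<phi> = (\<Prod>i<j. N i (\<epsilon> i \<phi>))" for \<phi>
  \<comment> \<open>Value of one unit of weight that survives stage \<open>j\<close>:
    \<open>A\<close> times the expected factor of the later stages.\<close>
  define P where "P = A * p ^ (J - Suc j)"
  define A' where "A' = (A / 2)\<^sup>2"
  have A'_nonneg: "A' \<ge> 0" by (simp add: A'_def)
  have P: "P > 0" using A_pos p_pos by (simp add: P_def)
  \<comment> \<open>The part of a pair product that stage \<open>j\<close> does not change.\<close>
  define rest where "rest m \<phi> \<phi>' = (\<Prod>i\<in>{..<m}-{j}. pair_weight j N i \<phi> \<phi>')" for m \<phi> \<phi>'
  define g where "g \<phi> \<phi>' =
      A * (\<Sum>l\<in>{Suc j..<J}. p ^ (J - l) / (4 * a l) * (if \<epsilon> l \<phi> = \<epsilon> l \<phi>' then rest l \<phi> \<phi>' else 0))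
      + A' * (if \<rho> \<phi> = \<rho> \<phi>' then rest J \<phi> \<phi>' else 0)" for \<phi> \<phi>'
  have f0_nonneg: "f0 \<phi> \<ge> 0" for \<phi> using N by (simp add: f0_def prod_nonneg)
  have rest_nonneg: "rest m \<phi> \<phi>' \<ge> 0" for m \<phi> \<phi>'
    using pair_weight_nonneg[OF N] by (simp add: rest_def prod_nonneg)
  have g_nonneg: "g \<phi> \<phi>' \<ge> 0" for \<phi> \<phi>'
  proof -
    have "(if c then rest m \<phi> \<phi>' else 0) \<ge> 0" for c m using rest_nonneg by simp
    thus ?thesis unfolding g_def using A_pos A'_nonneg p_pos a_pos
      by (intro add_nonneg_nonneg mult_nonneg_nonneg sum_nonneg divide_nonneg_pos) simp_all
  qed
  have mean: "mean j N \<phi> = p * (p ^ (J - Suc j) * f0 \<phi>)"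
    and mean_Suc: "mean (Suc j) (N(j := M)) \<phi> = (p ^ (J - Suc j) * f0 \<phi>) * M (\<epsilon> j \<phi>)" for \<phi> M
  proof -
    have split: "(\<Prod>i<J. F i) = (\<Prod>i<j. F i) * F j * (\<Prod>i=Suc j..<J. F i)" for F :: "nat \<Rightarrow> real"
    proof -
      have "prod F {0..<Suc j} * prod F {Suc j..<J} = prod F {0..<J}"
        using j by (intro prod.atLeastLessThan_concat) auto
      thus ?thesis by (simp add: atLeast0LessThan)
    qed
    show "mean j N \<phi> = p * (p ^ (J - Suc j) * f0 \<phi>)"
      unfolding mean_def split f0_def by (simp add: mult_ac)
    show "mean (Suc j) (N(j := M)) \<phi> = (p ^ (J - Suc j) * f0 \<phi>) * M (\<epsilon> j \<phi>)"
      unfolding mean_def split f0_def by (simp add: mult_ac)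
  qed
  have sm: "second_moment m r j N = (\<Sum>z\<in>S\<times>S. (if r (fst z) = r (snd z) then rest m (fst z) (snd z) else 0)
        * (p\<^sup>2 + (if \<epsilon> j (fst z) = \<epsilon> j (snd z) then p else 0)))"
    and sm_Suc: "second_moment m r (Suc j) (N(j := M))
      = (\<Sum>z\<in>S\<times>S. (if r (fst z) = r (snd z) then rest m (fst z) (snd z) else 0)
        * (M (\<epsilon> j (fst z)) * M (\<epsilon> j (snd z))))" if m: "j < m" for m r M
  proof -
    have 1: "(\<Prod>i<m. pair_weight j N i \<phi> \<phi>') = rest m \<phi> \<phi>' * (p\<^sup>2 + (if \<epsilon> j \<phi> = \<epsilon> j \<phi>' then p else 0))"
      for \<phi> \<phi>' using m by (subst prod.remove[of _ j]) (auto simp: rest_def pair_weight_def)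
    have "pair_weight (Suc j) (N(j := M)) i \<phi> \<phi>' = pair_weight j N i \<phi> \<phi>'" if "i \<noteq> j" for i \<phi> \<phi>'
      using that by (auto simp: pair_weight_def)
    hence 2: "(\<Prod>i<m. pair_weight (Suc j) (N(j := M)) i \<phi> \<phi>') = rest m \<phi> \<phi>' * (M (\<epsilon> j \<phi>) * M (\<epsilon> j \<phi>'))"
      for \<phi> \<phi>' using m
      by (subst prod.remove[of _ j]) (auto simp: rest_def pair_weight_def[of _ _ j])
    show "second_moment m r j N = (\<Sum>z\<in>S\<times>S. (if r (fst z) = r (snd z) then rest m (fst z) (snd z) else 0)
        * (p\<^sup>2 + (if \<epsilon> j (fst z) = \<epsilon> j (snd z) then p else 0)))"
      unfolding second_moment_def 1 by (intro sum.cong) auto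
    show "second_moment m r (Suc j) (N(j := M))
      = (\<Sum>z\<in>S\<times>S. (if r (fst z) = r (snd z) then rest m (fst z) (snd z) else 0)
        * (M (\<epsilon> j (fst z)) * M (\<epsilon> j (snd z))))"
      unfolding second_moment_def 2 by (intro sum.cong) auto
  qed
  have g_sum: "(\<Sum>z\<in>S\<times>S. g (fst z) (snd z) * V z)
    = A * (\<Sum>l\<in>{Suc j..<J}. p ^ (J - l) / (4 * a l)
          * (\<Sum>z\<in>S\<times>S. (if \<epsilon> l (fst z) = \<epsilon> l (snd z) then rest l (fst z) (snd z) else 0) * V z))
      + A' * (\<Sum>z\<in>S\<times>S. (if \<rho> (fst z) = \<rho> (snd z) then rest J (fst z) (snd z) else 0) * V z)" for V
  proof -
    have "(\<Sum>z\<in>S\<times>S. g (fst z) (snd z) * V z)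
      = A * (\<Sum>z\<in>S\<times>S. \<Sum>l\<in>{Suc j..<J}. p ^ (J - l) / (4 * a l)
          * ((if \<epsilon> l (fst z) = \<epsilon> l (snd z) then rest l (fst z) (snd z) else 0) * V z))
      + A' * (\<Sum>z\<in>S\<times>S. (if \<rho> (fst z) = \<rho> (snd z) then rest J (fst z) (snd z) else 0) * V z)"
      unfolding g_def distrib_right sum.distrib sum_distrib_right sum_distrib_left
      by (simp only: mult.assoc)
    also have "(\<Sum>z\<in>S\<times>S. \<Sum>l\<in>{Suc j..<J}. p ^ (J - l) / (4 * a l)
          * ((if \<epsilon> l (fst z) = \<epsilon> l (snd z) then rest l (fst z) (snd z) else 0) * V z))
      = (\<Sum>l\<in>{Suc j..<J}. p ^ (J - l) / (4 * a l)
          * (\<Sum>z\<in>S\<times>S. (if \<epsilon> l (fst z) = \<epsilon> l (snd z) then rest l (fst z) (snd z) else 0) * V z))"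
      by (subst sum.swap) (simp only: sum_distrib_left)
    finally show ?thesis .
  qed
  have "q * (length h + k) \<le> q * (J * k)"
  proof (intro mult_left_mono)
    have "length h + k \<le> Suc j * k" using h(2) by simp
    also have "\<dots> \<le> J * k" using j by (intro mult_right_mono) auto
    finally show "length h + k \<le> J * k" .
  qed simp
  with budget have bd: "q * (length h + k) \<le> b" by linarith
  have P_nonneg: "P * f0 \<phi> \<ge> 0" for \<phi> using P f0_nonneg by simp
  \<comment> \<open>The weights carry the factor \<open>P\<close>, so the scale must carry it too;
    then both parts of the damage are multiplied by \<open>P\<close> alike, as \<open>loss\<close>
    records.\<close>
  have Pa: "P * a j > 0" using P a_pos by simp
  from stage_structures[where f = "\<lambda>\<phi>. P * f0 \<phi>" and g = g and a = "P * a j",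
      OF h(1) D_edges[OF j] D_ne[OF j] finite_S \<epsilon>_D[OF j] P_nonneg g_nonneg Pa bd p_eq[OF j]]
  obtain h' M where hM: "follows n s h'" "length h' \<le> length h + k" "maker_edges h \<subseteq> maker_edges h'"
    "\<forall>e. M e \<ge> 0" "{e\<in>D j. M e \<noteq> 0} \<subseteq> maker_edges h'"
    and ineq: "p * (\<Sum>\<phi>\<in>S. P * f0 \<phi>)
      - p * (P * a j * real b
          + (\<Sum>z\<in>S\<times>S. if \<epsilon> j (fst z) = \<epsilon> j (snd z) then P * f0 (fst z) * (P * f0 (snd z)) else 0)
             / (4 * (P * a j)))
      - (\<Sum>z\<in>S\<times>S. g (fst z) (snd z) * (p\<^sup>2 + (if \<epsilon> j (fst z) = \<epsilon> j (snd z) then p else 0)))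
    \<le> (\<Sum>\<phi>\<in>S. P * f0 \<phi> * M (\<epsilon> j \<phi>))
      - (\<Sum>z\<in>S\<times>S. g (fst z) (snd z) * (M (\<epsilon> j (fst z)) * M (\<epsilon> j (snd z))))"
    by blast
  have sq: "(\<Sum>z\<in>S\<times>S. if \<epsilon> j (fst z) = \<epsilon> j (snd z) then P * f0 (fst z) * (P * f0 (snd z)) else 0)
    = P * P * second_moment j (\<epsilon> j) j N"
    unfolding second_moment_def f0_def pair_weight_def sum_distrib_left
    by (intro sum.cong) (auto simp: prod.distrib)
  have pP: "p * P = A * p ^ (J - j)"
    using j unfolding P_def by (simp add: Suc_diff_Suc flip: power_Suc)
  have loss: "p * (P * a j * real b + P * P * second_moment j (\<epsilon> j) j N / (4 * (P * a j)))
    = A * (p ^ (J - j) * (a j * real b + second_moment j (\<epsilon> j) j N / (4 * a j)))"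
  proof -
    have "p * (P * a j * real b + P * P * second_moment j (\<epsilon> j) j N / (4 * (P * a j)))
      = (p * P) * (a j * real b + second_moment j (\<epsilon> j) j N / (4 * a j))"
      using P a_pos[of j] by (simp add: field_simps)
    thus ?thesis unfolding pP by simp
  qed
  have lin: "p * (\<Sum>\<phi>\<in>S. P * f0 \<phi>) = A * (\<Sum>\<phi>\<in>S. mean j N \<phi>)"
    "(\<Sum>\<phi>\<in>S. P * f0 \<phi> * M (\<epsilon> j \<phi>)) = A * (\<Sum>\<phi>\<in>S. mean (Suc j) (N(j := M)) \<phi>)"
    unfolding mean mean_Suc P_def sum_distrib_left by (simp_all add: mult_ac)
  have heads: "(\<Sum>l\<in>{j..<J}. F l) = F j + (\<Sum>l\<in>{Suc j..<J}. F l)" for F :: "nat \<Rightarrow> real"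
    using j by (simp add: sum.atLeast_Suc_lessThan)
  define tail where "tail = A * (\<Sum>l\<in>{Suc j..<J}. p ^ (J - l) * (a l * real b))"
  have quad: "(\<Sum>z\<in>S\<times>S. g (fst z) (snd z) * (p\<^sup>2 + (if \<epsilon> j (fst z) = \<epsilon> j (snd z) then p else 0)))
      = A * (\<Sum>l\<in>{Suc j..<J}. p ^ (J - l) / (4 * a l) * second_moment l (\<epsilon> l) j N)
        + A' * second_moment J \<rho> j N"
    "(\<Sum>z\<in>S\<times>S. g (fst z) (snd z) * (M (\<epsilon> j (fst z)) * M (\<epsilon> j (snd z))))
      = A * (\<Sum>l\<in>{Suc j..<J}. p ^ (J - l) / (4 * a l) * second_moment l (\<epsilon> l) (Suc j) (N(j := M)))
        + A' * second_moment J \<rho> (Suc j) (N(j := M))"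
    unfolding g_sum using j by (simp_all add: sm sm_Suc)
  have "potential j N = A * (\<Sum>\<phi>\<in>S. mean j N \<phi>)
      - A * (p ^ (J - j) * (a j * real b + second_moment j (\<epsilon> j) j N / (4 * a j))) - tail
      - (\<Sum>z\<in>S\<times>S. g (fst z) (snd z) * (p\<^sup>2 + (if \<epsilon> j (fst z) = \<epsilon> j (snd z) then p else 0)))"
    unfolding potential_def A'_def[symmetric] heads quad tail_def by (simp add: distrib_left sum.distrib)
  also have "\<dots> \<le> A * (\<Sum>\<phi>\<in>S. mean (Suc j) (N(j := M)) \<phi>) - tail
      - (\<Sum>z\<in>S\<times>S. g (fst z) (snd z) * (M (\<epsilon> j (fst z)) * M (\<epsilon> j (snd z))))"
    using ineq unfolding sq loss lin by linarith
  also have "\<dots> = potential (Suc j) (N(j := M))"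
    unfolding potential_def A'_def[symmetric] quad tail_def by (simp add: distrib_left sum.distrib)
  finally have "potential j N \<le> potential (Suc j) (N(j := M))" .
  moreover have "length h' \<le> Suc j * k" using hM(2) h(2) by simp
  ultimately show ?thesis using hM by blast
qed

lemma all_stages:
  assumes "j \<le> J"
  shows "\<exists>h N. follows n s h \<and> length h \<le> j * k \<and> (\<forall>i e. N i e \<ge> 0) \<and>
    (\<forall>i<j. {e\<in>D i. N i e \<noteq> 0} \<subseteq> maker_edges h) \<and> potential 0 (\<lambda>_ _. 0) \<le> potential j N"
  using assms
proof (induction j)
  case 0
  show ?case by (intro exI[of _ "[]"] exI[of _ "\<lambda>_ _. 0"]) (auto intro: follows.start)
next
  case (Suc j)
  then obtain h N where h: "follows n s h" "length h \<le> j * k" and N: "\<And>i e. N i e \<ge> 0"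
    and sup: "\<forall>i<j. {e\<in>D i. N i e \<noteq> 0} \<subseteq> maker_edges h"
    and pot: "potential 0 (\<lambda>_ _. 0) \<le> potential j N" by auto
  from next_stage[where N = N, OF h _ N] Suc.prems obtain h' M where
    h': "follows n s h'" "length h' \<le> Suc j * k" "maker_edges h \<subseteq> maker_edges h'"
    and M: "\<forall>e. M e \<ge> 0" "{e\<in>D j. M e \<noteq> 0} \<subseteq> maker_edges h'"
    and pot': "potential j N \<le> potential (Suc j) (N(j := M))" by auto
  have "\<forall>i<Suc j. {e\<in>D i. (N(j := M)) i e \<noteq> 0} \<subseteq> maker_edges h'"
  proof (intro allI impI)
    fix i assume "i < Suc j"
    then consider "i < j" | "i = j" by linarith
    thus "{e\<in>D i. (N(j := M)) i e \<noteq> 0} \<subseteq> maker_edges h'"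
    proof cases
      case 1
      with sup have "{e\<in>D i. N i e \<noteq> 0} \<subseteq> maker_edges h" by blast
      with 1 h'(3) show ?thesis by auto
    qed (use M in simp)
  qed
  moreover have "\<forall>i e. (N(j := M)) i e \<ge> 0" using N M by simp
  ultimately show ?case using h' order_trans[OF pot pot'] by blast
qed

text \<open>After the last stage \<open>potential\<close> is the sum of
  \<open>A * Y e - (A / 2)\<^sup>2 * (Y e)\<^sup>2\<close> over the missing edges. A summand
  vanishes unless \<open>e\<close> closes a structure that Maker owns, and it is at most 1 because
  \<open>(1 - A / 2 * Y e)\<^sup>2\<close> is nonnegative.\<close>

lemma many_closing_pairs:
  shows "\<exists>h. follows n s h \<and> length h \<le> J * k \<and>
    potential 0 (\<lambda>_ _. 0) \<le> real (card (\<rho> ` {\<phi>\<in>S. \<forall>i<J. \<epsilon> i \<phi> \<in> maker_edges h}))"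
proof -
  obtain h N where h: "follows n s h" "length h \<le> J * k" and N: "\<And>i e. N i e \<ge> 0"
    and sup: "\<And>i. i < J \<Longrightarrow> {e\<in>D i. N i e \<noteq> 0} \<subseteq> maker_edges h"
    and pot: "potential 0 (\<lambda>_ _. 0) \<le> potential J N"
    using all_stages[of J] by auto
  define S' where "S' = {\<phi>\<in>S. \<forall>i<J. \<epsilon> i \<phi> \<in> maker_edges h}"
  define y where "y \<phi> = (\<Prod>i<J. N i (\<epsilon> i \<phi>))" for \<phi>
  define Y where "Y e = (\<Sum>\<phi> | \<phi> \<in> S \<and> \<rho> \<phi> = e. y \<phi>)" for e
  have Y_0: "Y e = 0" if e: "e \<notin> \<rho> ` S'" for e
    unfolding Y_def
  proof (rule sum.neutral, intro ballI)
    fix \<phi> assume \<phi>: "\<phi> \<in> {\<phi> \<in> S. \<rho> \<phi> = e}"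
    with e have "\<phi> \<notin> S'" by auto
    with \<phi> obtain i where i: "i < J" "\<epsilon> i \<phi> \<notin> maker_edges h" by (auto simp: S'_def)
    with sup[OF i(1)] \<epsilon>_D[OF i(1)] \<phi> have "N i (\<epsilon> i \<phi>) = 0" by auto
    with i(1) show "y \<phi> = 0" by (auto simp: y_def)
  qed
  have "(\<Sum>\<phi>\<in>S. y \<phi>) = (\<Sum>e\<in>\<rho>`S. Y e)"
    unfolding Y_def by (rule sum.group[symmetric]) (use finite_S in auto)
  moreover have "second_moment J \<rho> J N = (\<Sum>e\<in>\<rho>`S. (Y e)\<^sup>2)"
    unfolding second_moment_def Y_def
    by (subst sum_square_fibres) (use finite_S in \<open>auto simp: pair_weight_def y_def prod.distrib intro!: sum.cong\<close>)
  ultimately have "potential J N = A * (\<Sum>e\<in>\<rho>`S. Y e) - (A / 2)\<^sup>2 * (\<Sum>e\<in>\<rho>`S. (Y e)\<^sup>2)"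
    by (simp add: potential_def mean_def y_def)
  also have "\<dots> = (\<Sum>e\<in>\<rho>`S. A * Y e - (A / 2)\<^sup>2 * (Y e)\<^sup>2)"
    by (simp add: sum_subtractf sum_distrib_left)
  also have "\<dots> = (\<Sum>e\<in>\<rho>`S'. A * Y e - (A / 2)\<^sup>2 * (Y e)\<^sup>2)"
    by (rule sum.mono_neutral_right) (use finite_S Y_0 in \<open>auto simp: S'_def\<close>)
  also have "\<dots> \<le> (\<Sum>e\<in>\<rho>`S'. 1)"
  proof (rule sum_mono)
    fix e
    have "0 \<le> (1 - A / 2 * Y e)\<^sup>2" by simp
    thus "A * Y e - (A / 2)\<^sup>2 * (Y e)\<^sup>2 \<le> 1" by (simp add: power2_eq_square algebra_simps)
  qed
  finally show ?thesis using h pot by (auto simp: S'_def)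
qed

end

section \<open>Second moments for \<open>K\<^sub>4\<close> minus an edge\<close>

text \<open>The position in the list is the stage in which the edge is played.\<close>

fun k4_edge :: "nat \<Rightarrow> nat \<times> nat \<times> nat \<times> nat \<Rightarrow> edge" where
  "k4_edge i (u, v, x, y) = [{x, y}, {u, x}, {v, x}, {u, y}, {v, y}] ! i"

fun k4_root :: "nat \<times> nat \<times> nat \<times> nat \<Rightarrow> edge" where
  "k4_root (u, v, x, y) = {u, v}"

text \<open>The intervals are the classes \<open>U\<close>, \<open>V\<close>, \<open>X\<close>,
  \<open>Y\<close>. As they are disjoint, two structures share their edge number \<open>i\<close>
  only if both ends agree coordinate by coordinate.\<close>

definition quads :: "nat \<Rightarrow> (nat \<times> nat \<times> nat \<times> nat) set" where
  "quads L = {..<L} \<times> {L..<2*L} \<times> {2*L..<3*L} \<times> {3*L..<4*L}"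

lemma finite_quads [simp]: "finite (quads L)"
  by (simp add: quads_def)

lemma card_quads: "card (quads L) = L ^ 4"
  by (simp add: quads_def card_cartesian_product eval_nat_numeral)

text \<open>Two structures with the same edge \<open>l\<close> (or the same missing edge) may differ in two vertices. In
  the next lemmas \<open>c\<close> stands for \<open>1 + 1 / p\<close>, the factor gained by each coinciding edge.\<close>

lemma sum_two_vertices_le:
  fixes F :: "'a \<Rightarrow> 'b \<Rightarrow> real"
  assumes fin: "finite A" "finite B" and "card A = L" "card B = L" and "d \<ge> 0" "e \<ge> 0"
    and F: "\<And>a b. a \<in> A \<Longrightarrow> b \<in> B \<Longrightarrow>
      F a b \<le> 1 + (if a = a0 then d else 0) + (if b = b0 then d else 0)
        + (if a = a0 then if b = b0 then e else 0 else 0)"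
  shows "(\<Sum>z\<in>A\<times>B. F (fst z) (snd z)) \<le> real L ^ 2 + 2 * real L * d + e"
proof -
  have "(\<Sum>z\<in>A\<times>B. F (fst z) (snd z)) \<le> (\<Sum>a\<in>A. \<Sum>b\<in>B. 1 + (if a = a0 then d else 0)
      + (if b = b0 then d else 0) + (if a = a0 then if b = b0 then e else 0 else 0))"
    unfolding sum.cartesian_product split_def
  proof (rule sum_mono)
    fix z assume "z \<in> A \<times> B"
    with F[of "fst z" "snd z"]
    show "F (fst z) (snd z) \<le> 1 + (if fst z = a0 then d else 0) + (if snd z = b0 then d else 0)
        + (if fst z = a0 then if snd z = b0 then e else 0 else 0)"
      by (simp only: mem_Times_iff simp_thms)
  qed
  also have "\<dots> \<le> real L ^ 2 + 2 * real L * d + e"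
  proof -
    have "(\<Sum>b\<in>B. if a = a0 then if b = b0 then e else 0 else 0)
        = (if a = a0 then if b0 \<in> B then e else 0 else 0)" for a
      using fin by simp
    hence "(\<Sum>a\<in>A. \<Sum>b\<in>B. 1 + (if a = a0 then d else 0) + (if b = b0 then d else 0)
        + (if a = a0 then if b = b0 then e else 0 else 0))
      = real L ^ 2 + (if a0 \<in> A then real L * d else 0) + (if b0 \<in> B then real L * d else 0)
        + (if a0 \<in> A \<and> b0 \<in> B then e else 0)"
      using assms by (simp add: sum.distrib power2_eq_square distrib_left
          if_distrib[of "\<lambda>t. _ * t"] cong: if_cong)
    thus ?thesis using \<open>d \<ge> 0\<close> \<open>e \<ge> 0\<close> by auto
  qed
  finally show ?thesis .
qed

text \<open>Sharing edge \<open>l\<close> leaves two vertices free. One free vertex is joined to at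
  most two fixed ones, so its agreement alone yields at most \<open>c ^ 2\<close>; if both agree, at
  most the four earlier edges coincide.\<close>

lemma k4_fibre_sum:
  fixes c :: real
  assumes \<phi>: "\<phi> \<in> quads L" and l: "l < 5" and c: "c \<ge> 1"
  shows "(\<Sum>\<phi>'\<in>quads L. if k4_edge l \<phi> = k4_edge l \<phi>'
      then \<Prod>i<l. if k4_edge i \<phi> = k4_edge i \<phi>' then c else 1 else 0)
    \<le> real L ^ 2 + 2 * real L * c ^ 2 + c ^ 4"
proof -
  obtain u v x y where [simp]: "\<phi> = (u, v, x, y)" by (cases \<phi>)
  have r: "u < L" "L \<le> v" "v < 2*L" "2*L \<le> x" "x < 3*L" "3*L \<le> y" "y < 4*L"
    using \<phi> by (auto simp: quads_def)
  have pows: "0 \<le> c" "c \<le> c^2" "c \<le> c^4" "c^2 \<le> c^4" "c^3 \<le> c^4" "1 \<le> c^2" "1 \<le> c^4"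
    using c power_increasing[of 1 2 c] power_increasing[of 1 4 c] power_increasing[of 2 4 c]
      power_increasing[of 3 4 c] by auto
  let ?F = "\<lambda>\<phi>'. \<Prod>i<l. if k4_edge i \<phi> = k4_edge i \<phi>' then c else 1"
  note lessThan_numeral = eval_nat_numeral lessThan_Suc
  from l consider "l = 0" | "l = 1" | "l = 2" | "l = 3" | "l = 4" by linarith
  thus ?thesis
  proof cases
    \<comment> \<open>Case numbers run one ahead of \<open>l\<close>. Each reindexing fixes the ends
      of edge \<open>l\<close> and sums over the other two vertices.\<close>
    case 1
    have "(\<Sum>\<phi>'\<in>quads L. if k4_edge l \<phi> = k4_edge l \<phi>' then ?F \<phi>' else 0)
      = (\<Sum>z\<in>{..<L}\<times>{L..<2*L}. ?F (fst z, snd z, x, y))"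
      unfolding sum.inter_filter[OF finite_quads, symmetric]
      by (rule sum.reindex_bij_witness[where i = "\<lambda>(a, b). (a, b, x, y)" and j = "\<lambda>(a, b, _, _). (a, b)"])
        (use r 1 in \<open>auto simp: quads_def doubleton_eq_iff\<close>)
    also have "\<dots> \<le> real L ^ 2 + 2 * real L * c ^ 2 + c ^ 4"
      by (rule sum_two_vertices_le[where F = "\<lambda>a b. ?F (a, b, x, y)" and ?a0.0 = u and ?b0.0 = v])
        (use r 1 pows in auto)
    finally show ?thesis .
  next
    case 2
    have "(\<Sum>\<phi>'\<in>quads L. if k4_edge l \<phi> = k4_edge l \<phi>' then ?F \<phi>' else 0)
      = (\<Sum>z\<in>{L..<2*L}\<times>{3*L..<4*L}. ?F (u, fst z, x, snd z))"
      unfolding sum.inter_filter[OF finite_quads, symmetric]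
      by (rule sum.reindex_bij_witness[where i = "\<lambda>(a, b). (u, a, x, b)" and j = "\<lambda>(_, a, _, b). (a, b)"])
        (use r 2 in \<open>auto simp: quads_def doubleton_eq_iff\<close>)
    also have "\<dots> \<le> real L ^ 2 + 2 * real L * c ^ 2 + c ^ 4"
      by (rule sum_two_vertices_le[where F = "\<lambda>a b. ?F (u, a, x, b)" and ?a0.0 = v and ?b0.0 = y])
        (use r 2 pows in \<open>auto simp: lessThan_numeral doubleton_eq_iff\<close>)
    finally show ?thesis .
  next
    case 3
    have "(\<Sum>\<phi>'\<in>quads L. if k4_edge l \<phi> = k4_edge l \<phi>' then ?F \<phi>' else 0)
      = (\<Sum>z\<in>{..<L}\<times>{3*L..<4*L}. ?F (fst z, v, x, snd z))"
      unfolding sum.inter_filter[OF finite_quads, symmetric]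
      by (rule sum.reindex_bij_witness[where i = "\<lambda>(a, b). (a, v, x, b)" and j = "\<lambda>(a, _, _, b). (a, b)"])
        (use r 3 in \<open>auto simp: quads_def doubleton_eq_iff\<close>)
    also have "\<dots> \<le> real L ^ 2 + 2 * real L * c ^ 2 + c ^ 4"
      by (rule sum_two_vertices_le[where F = "\<lambda>a b. ?F (a, v, x, b)" and ?a0.0 = u and ?b0.0 = y])
        (use r 3 pows in \<open>auto simp: lessThan_numeral doubleton_eq_iff\<close>)
    finally show ?thesis .
  next
    case 4
    have "(\<Sum>\<phi>'\<in>quads L. if k4_edge l \<phi> = k4_edge l \<phi>' then ?F \<phi>' else 0)
      = (\<Sum>z\<in>{L..<2*L}\<times>{2*L..<3*L}. ?F (u, fst z, snd z, y))"
      unfolding sum.inter_filter[OF finite_quads, symmetric]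
      by (rule sum.reindex_bij_witness[where i = "\<lambda>(a, b). (u, a, b, y)" and j = "\<lambda>(_, a, b, _). (a, b)"])
        (use r 4 in \<open>auto simp: quads_def doubleton_eq_iff\<close>)
    also have "\<dots> \<le> real L ^ 2 + 2 * real L * c ^ 2 + c ^ 4"
      by (rule sum_two_vertices_le[where F = "\<lambda>a b. ?F (u, a, b, y)" and ?a0.0 = v and ?b0.0 = x])
        (use r 4 pows in \<open>auto simp: lessThan_numeral doubleton_eq_iff\<close>)
    finally show ?thesis .
  next
    case 5
    have "(\<Sum>\<phi>'\<in>quads L. if k4_edge l \<phi> = k4_edge l \<phi>' then ?F \<phi>' else 0)
      = (\<Sum>z\<in>{..<L}\<times>{2*L..<3*L}. ?F (fst z, v, snd z, y))"
      unfolding sum.inter_filter[OF finite_quads, symmetric]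
      by (rule sum.reindex_bij_witness[where i = "\<lambda>(a, b). (a, v, b, y)" and j = "\<lambda>(a, _, b, _). (a, b)"])
        (use r 5 in \<open>auto simp: quads_def doubleton_eq_iff\<close>)
    also have "\<dots> \<le> real L ^ 2 + 2 * real L * c ^ 2 + c ^ 4"
      by (rule sum_two_vertices_le[where F = "\<lambda>a b. ?F (a, v, b, y)" and ?a0.0 = u and ?b0.0 = x])
        (use r 5 pows in \<open>auto simp: lessThan_numeral doubleton_eq_iff\<close>)
    finally show ?thesis .
  qed
qed

text \<open>Here \<open>x\<close> and \<open>y\<close> are free. Either one alone accounts for its
  two edges to \<open>u\<close> and \<open>v\<close>; if both agree, all five edges coincide, whence
  \<open>c ^ 5\<close>.\<close>

lemma k4_root_fibre_sum:
  fixes c :: real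
  assumes \<phi>: "\<phi> \<in> quads L" and c: "c \<ge> 1"
  shows "(\<Sum>\<phi>'\<in>quads L. if k4_root \<phi> = k4_root \<phi>'
      then \<Prod>i<5. if k4_edge i \<phi> = k4_edge i \<phi>' then c else 1 else 0)
    \<le> real L ^ 2 + 2 * real L * c ^ 2 + c ^ 5"
proof -
  obtain u v x y where [simp]: "\<phi> = (u, v, x, y)" by (cases \<phi>)
  have r: "u < L" "L \<le> v" "v < 2*L" "2*L \<le> x" "x < 3*L" "3*L \<le> y" "y < 4*L"
    using \<phi> by (auto simp: quads_def)
  have pows: "0 \<le> c" "0 \<le> c^2" "0 \<le> c^5" using c by auto
  let ?F = "\<lambda>\<phi>'. \<Prod>i<5. if k4_edge i \<phi> = k4_edge i \<phi>' then c else 1"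
  note lessThan_numeral = eval_nat_numeral lessThan_Suc
    have "(\<Sum>\<phi>'\<in>quads L. if k4_root \<phi> = k4_root \<phi>' then ?F \<phi>' else 0)
      = (\<Sum>z\<in>{2*L..<3*L}\<times>{3*L..<4*L}. ?F (u, v, fst z, snd z))"
      unfolding sum.inter_filter[OF finite_quads, symmetric]
      by (rule sum.reindex_bij_witness[where i = "\<lambda>(a, b). (u, v, a, b)" and j = "\<lambda>(_, _, a, b). (a, b)"])
        (use r c in \<open>auto simp: quads_def doubleton_eq_iff\<close>)
    also have "\<dots> \<le> real L ^ 2 + 2 * real L * c ^ 2 + c ^ 5"
      by (rule sum_two_vertices_le[where F = "\<lambda>a b. ?F (u, v, a, b)" and ?a0.0 = x and ?b0.0 = y])
        (use r c pows in \<open>auto simp: lessThan_numeral doubleton_eq_iff\<close>)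
    finally show ?thesis .
qed

section \<open>Maker's win and the thresholds\<close>

lemma card_doubletons:
  assumes "finite A" "finite B" "A \<inter> B = {}"
  shows "card ((\<lambda>z. {fst z, snd z}) ` (A \<times> B)) = card A * card B"
proof -
  have "inj_on (\<lambda>z. {fst z, snd z}) (A \<times> B)"
    using assms(3) by (auto simp: inj_on_def doubleton_eq_iff)
  thus ?thesis by (simp add: card_image card_cartesian_product)
qed

text \<open>Each stage plays on the complete bipartite graph between two of the four classes. The
  witnesses take the first vertex of each of the other two, available since
  \<open>L > 0\<close>.\<close>

lemma k4_edge_image:
  assumes "i < 5" "L > 0"
  shows "\<exists>A B. k4_edge i ` quads L = (\<lambda>z. {fst z, snd z}) ` (A \<times> B) \<and> A \<inter> B = {} \<and>
    A \<subseteq> {..<4*L} \<and> B \<subseteq> {..<4*L} \<and> card A = L \<and> card B = L"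
proof -
  let ?U = "{..<L}" and ?V = "{L..<2*L}" and ?X = "{2*L..<3*L}" and ?Y = "{3*L..<4*L}"
  have image: "k4_edge i ` quads L = (\<lambda>z. {fst z, snd z}) ` (A \<times> B)"
    if "\<And>\<phi>. \<phi> \<in> quads L \<Longrightarrow> \<pi> \<phi> \<in> A \<times> B \<and> k4_edge i \<phi> = {fst (\<pi> \<phi>), snd (\<pi> \<phi>)}"
      and "\<And>a b. a \<in> A \<Longrightarrow> b \<in> B \<Longrightarrow> w a b \<in> quads L \<and> k4_edge i (w a b) = {a, b}" for A B w \<pi>
  proof (intro equalityI image_subsetI)
    fix \<phi> assume "\<phi> \<in> quads L"
    with that(1) show "k4_edge i \<phi> \<in> (\<lambda>z. {fst z, snd z}) ` (A \<times> B)" by blast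
  next
    fix z assume "z \<in> A \<times> B"
    with that(2)[of "fst z" "snd z"] show "{fst z, snd z} \<in> k4_edge i ` quads L"
      by (intro image_eqI[of _ _ "w (fst z) (snd z)"]) auto
  qed
  from assms(1) consider "i = 0" | "i = 1" | "i = 2" | "i = 3" | "i = 4" by linarith
  thus ?thesis
  proof cases
    case 1
    have "k4_edge i ` quads L = (\<lambda>z. {fst z, snd z}) ` (?X \<times> ?Y)"
      by (rule image[where w = "\<lambda>a b. (0, L, a, b)" and \<pi> = "\<lambda>(u, v, x, y). (x, y)"]) (use 1 assms(2) in \<open>auto simp: quads_def\<close>)
    thus ?thesis by (intro exI[of _ ?X] exI[of _ ?Y]) auto
  next
    case 2
    have "k4_edge i ` quads L = (\<lambda>z. {fst z, snd z}) ` (?U \<times> ?X)"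
      by (rule image[where w = "\<lambda>a b. (a, L, b, 3*L)" and \<pi> = "\<lambda>(u, v, x, y). (u, x)"]) (use 2 assms(2) in \<open>auto simp: quads_def\<close>)
    thus ?thesis by (intro exI[of _ ?U] exI[of _ ?X]) auto
  next
    case 3
    have "k4_edge i ` quads L = (\<lambda>z. {fst z, snd z}) ` (?V \<times> ?X)"
      by (rule image[where w = "\<lambda>a b. (0, a, b, 3*L)" and \<pi> = "\<lambda>(u, v, x, y). (v, x)"]) (use 3 assms(2) in \<open>auto simp: quads_def\<close>)
    thus ?thesis by (intro exI[of _ ?V] exI[of _ ?X]) auto
  next
    case 4
    have "k4_edge i ` quads L = (\<lambda>z. {fst z, snd z}) ` (?U \<times> ?Y)"
      by (rule image[where w = "\<lambda>a b. (a, L, 2*L, b)" and \<pi> = "\<lambda>(u, v, x, y). (u, y)"]) (use 4 assms(2) in \<open>auto simp: quads_def\<close>)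
    thus ?thesis by (intro exI[of _ ?U] exI[of _ ?Y]) auto
  next
    case 5
    have "k4_edge i ` quads L = (\<lambda>z. {fst z, snd z}) ` (?V \<times> ?Y)"
      by (rule image[where w = "\<lambda>a b. (0, a, 2*L, b)" and \<pi> = "\<lambda>(u, v, x, y). (v, y)"]) (use 5 assms(2) in \<open>auto simp: quads_def\<close>)
    thus ?thesis by (intro exI[of _ ?V] exI[of _ ?Y]) auto
  qed
qed

lemma card_k4_edge_image:
  assumes "i < 5" "L > 0"
  shows "card (k4_edge i ` quads L) = L\<^sup>2"
proof -
  obtain A B where *: "k4_edge i ` quads L = (\<lambda>z. {fst z, snd z}) ` (A \<times> B)" "A \<inter> B = {}"
    "A \<subseteq> {..<4*L}" "B \<subseteq> {..<4*L}" "card A = L" "card B = L"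
    using k4_edge_image[OF assms] by blast
  have "finite A" "finite B" using *(3,4) finite_subset by blast+
  from card_doubletons[OF this *(2)] * show ?thesis by (simp add: power2_eq_square)
qed

lemma k4_edge_image_subset:
  assumes "i < 5" "L > 0" "4 * L \<le> n"
  shows "k4_edge i ` quads L \<subseteq> K_edges n"
proof -
  obtain A B where *: "k4_edge i ` quads L = (\<lambda>z. {fst z, snd z}) ` (A \<times> B)" "A \<inter> B = {}"
    "A \<subseteq> {..<4*L}" "B \<subseteq> {..<4*L}" using k4_edge_image[OF assms(1,2)] by blast
  show ?thesis unfolding *(1)
  proof (rule image_subsetI)
    fix z assume "z \<in> A \<times> B"
    with *(2) have "fst z \<noteq> snd z" by auto
    with \<open>z \<in> A \<times> B\<close> *(3,4) assms(3) show "{fst z, snd z} \<in> K_edges n"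
      by (auto simp: nsets_def)
  qed
qed

lemma k4_root_in_K_edges: "\<phi> \<in> quads L \<Longrightarrow> 4 * L \<le> n \<Longrightarrow> k4_root \<phi> \<in> K_edges n"
  by (auto simp: quads_def nsets_def)

lemma k4_copy:
  assumes "\<phi> \<in> quads L" "4 * L \<le> n"
  shows "\<exists>K\<in>K4_copies n. K \<subseteq> insert (k4_root \<phi>) ((\<lambda>i. k4_edge i \<phi>) ` {..<5})"
proof -
  obtain u v x y where \<phi>: "\<phi> = (u, v, x, y)" by (cases \<phi>)
  with assms(1) have r: "u < L" "L \<le> v" "v < 2*L" "2*L \<le> x" "x < 3*L" "3*L \<le> y" "y < 4*L"
    by (auto simp: quads_def)
  have "{u, v, x, y} \<in> nsets {..<n} 4"
    using r assms(2) by (auto simp: nsets_def)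
  moreover have "nsets {u, v, x, y} 2 \<subseteq> insert (k4_root \<phi>) ((\<lambda>i. k4_edge i \<phi>) ` {..<5})"
  proof
    fix e assume "e \<in> nsets {u, v, x, y} 2"
    then obtain a b where "e = {a, b}" "a \<noteq> b" "{a, b} \<subseteq> {u, v, x, y}"
      by (auto simp: nsets_def card_2_iff)
    hence "e \<in> {{u, v}, {x, y}, {u, x}, {v, x}, {u, y}, {v, y}}"
      by (simp only: insert_subset insert_iff empty_iff empty_subsetI simp_thms)
        (elim conjE disjE; simp add: insert_commute)
    thus "e \<in> insert (k4_root \<phi>) ((\<lambda>i. k4_edge i \<phi>) ` {..<5})"
      by (simp add: \<phi> eval_nat_numeral lessThan_Suc) blast
  qed
  ultimately show ?thesis unfolding K4_copies_def by blast
qed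

section \<open>Maker's win against a fixed strategy\<close>

context breaker_play
begin

text \<open>The parameters are balanced: \<open>L ^ 4 * p ^ 5 = L ^ 2 = T ^ 10\<close>, so each pair
  \<open>uv\<close> is missing from one structure on average. All losses are small multiples of
  \<open>T ^ 10\<close>.\<close>

lemma maker_gets_k4:
  assumes t: "t \<ge> 3" "4 * t ^ 5 \<le> n" and q: "5000 * q \<le> t\<^sup>2"
  shows "\<exists>h. follows n s h \<and> (\<exists>K\<in>K4_copies n. K \<subseteq> maker_edges h)"
proof -
  define L where "L = t ^ 5"
  define T where "T = real t"
  define p where "p = 1 / T\<^sup>2"
  define b where "b = q * (5 * t ^ 8)"
  \<comment> \<open>100 times the mean weight of an edge in stage \<open>l\<close>, which is
    \<open>L ^ 4 * p ^ l / L ^ 2\<close>.\<close>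
  define a where "a l = 100 * T ^ 10 * p ^ l" for l
  have T: "T \<ge> 3" "T > 0" using t(1) by (auto simp: T_def)
  have p: "p > 0" using T by (simp add: p_def)
  have L: "L > 0" "4 * L \<le> n" using t by (auto simp: L_def)
  have real_L: "real L = T ^ 5" by (simp add: L_def T_def)
  \<comment> \<open>With the final second moment at most \<open>5 * T ^ 10\<close>, the choice
    \<open>A = 1/5\<close> leaves \<open>(1/5 - 5/100) * T ^ 10\<close> before Breaker's
    damage.\<close>
  interpret staged_play n q s "quads L" k4_edge k4_root "\<lambda>i. k4_edge i ` quads L" 5 "t ^ 8" b p "1/5" a
  proof
    have "(0, L, 2*L, 3*L) \<in> quads L" using L(1) by (auto simp: quads_def)
    thus "k4_edge i ` quads L \<noteq> {}" for i by blast
    show "k4_edge i ` quads L \<subseteq> K_edges n" if "i < 5" for i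
      by (rule k4_edge_image_subset[OF that L])
    show "p = real (t ^ 8) / real (card (k4_edge i ` quads L))" if "i < 5" for i
      using T power_diff[of T 2 10]
      by (simp add: card_k4_edge_image[OF that L(1)] real_L p_def T_def[symmetric] divide_simps)
    show "0 < a i" for i using p T by (simp add: a_def)
  qed (use p in \<open>auto simp: b_def\<close>)
  define c where "c = 1 + T\<^sup>2"
  have c1: "c \<ge> 1" by (simp add: c_def)
  have T2: "T\<^sup>2 \<ge> 9" using power_mono[OF T(1), of 2] by simp
  \<comment> \<open>\<open>c = 1 + 1 / p\<close>, and \<open>t \<ge> 3\<close> makes the 1 at most a
    ninth of \<open>T\<^sup>2\<close>.\<close>
  have c_le: "c \<le> 10 / 9 * T\<^sup>2" using T2 by (simp add: c_def)
  have c2: "c ^ 2 \<le> T ^ 5"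
  proof -
    have "c ^ 2 \<le> (10 / 9 * T\<^sup>2) ^ 2" using c_le c1 by (intro power_mono) auto
    also have "\<dots> = 100 / 81 * T ^ 4" by (simp add: power_mult_distrib power_divide flip: power_mult)
    also have "\<dots> \<le> T * T ^ 4" using T by (intro mult_right_mono) auto
    finally show ?thesis by (simp add: eval_nat_numeral)
  qed
  have c4: "c ^ 4 \<le> T ^ 10"
    using power_mono[OF c2, of 2] by (simp flip: power_mult)
  have c5: "c ^ 5 \<le> 2 * T ^ 10"
  proof -
    have "c ^ 5 \<le> (10 / 9 * T\<^sup>2) ^ 5" using c_le c1 by (intro power_mono) auto
    also have "\<dots> = (10 / 9) ^ 5 * T ^ 10"
      unfolding power_mult_distrib power_mult[symmetric] by simp
    also have "\<dots> \<le> 2 * T ^ 10" by (intro mult_right_mono) (auto simp: power_divide)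
    finally show ?thesis .
  qed
  \<comment> \<open>The common part of both fibre bounds; the remainder \<open>e\<close> is
    \<open>c ^ 4\<close> or \<open>c ^ 5\<close>, giving the totals \<open>4 * T ^ 10\<close> and
    \<open>5 * T ^ 10\<close>.\<close>
  have Lc: "real L ^ 2 + 2 * real L * c ^ 2 + e \<le> 3 * T ^ 10 + e" for e
  proof -
    have "real L * c ^ 2 \<le> T ^ 5 * T ^ 5" unfolding real_L using c2 T by (intro mult_left_mono) auto
    thus ?thesis by (simp add: real_L flip: power_mult power_add)
  qed
  have moment: "second_moment l r 0 N \<le> C * T ^ 30 * p ^ (2 * l)"
    if *: "\<And>\<phi>. \<phi> \<in> quads L \<Longrightarrow> (\<Sum>\<phi>'\<in>quads L. if r \<phi> = r \<phi>'
      then \<Prod>i<l. if k4_edge i \<phi> = k4_edge i \<phi>' then c else 1 else 0) \<le> C * T ^ 10" for l r C N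
  proof -
    \<comment> \<open>Before any stage, a pair weight is thus \<open>p\<^sup>2\<close>, times
      \<open>c\<close> for a coincidence, and the fibre bounds apply to the product.\<close>
    have "p\<^sup>2 * c = p\<^sup>2 + p"
      using T by (simp add: p_def c_def field_simps power2_eq_square)
    hence weight: "pair_weight 0 N i \<phi> \<phi>' = p\<^sup>2 * (if k4_edge i \<phi> = k4_edge i \<phi>' then c else 1)"
      for i \<phi> \<phi>' by (simp add: pair_weight_def)
    have "second_moment l r 0 N = (\<Sum>\<phi>\<in>quads L. \<Sum>\<phi>'\<in>quads L. if r \<phi> = r \<phi>'
      then p ^ (2 * l) * (\<Prod>i<l. if k4_edge i \<phi> = k4_edge i \<phi>' then c else 1) else 0)"
      unfolding second_moment_def weight sum.cartesian_product split_def
      by (intro sum.cong refl if_cong) (simp add: prod.distrib power_mult)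
    also have "\<dots> = p ^ (2 * l) * (\<Sum>\<phi>\<in>quads L. \<Sum>\<phi>'\<in>quads L. if r \<phi> = r \<phi>'
      then (\<Prod>i<l. if k4_edge i \<phi> = k4_edge i \<phi>' then c else 1) else 0)"
      unfolding sum_distrib_left by (intro sum.cong) auto
    also have "\<dots> \<le> p ^ (2 * l) * (\<Sum>\<phi>\<in>quads L. C * T ^ 10)"
      using p by (intro mult_left_mono sum_mono *) auto
    also have "\<dots> = C * T ^ 30 * p ^ (2 * l)"
    proof -
      have "T ^ 30 = (T ^ 5) ^ 4 * T ^ 10" by (simp flip: power_mult power_add)
      thus ?thesis by (simp add: card_quads real_L)
    qed
    finally show ?thesis .
  qed
  have moment_edge: "second_moment l (k4_edge l) 0 N \<le> 4 * T ^ 30 * p ^ (2 * l)" if "l < 5" for l N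
    by (rule moment, rule order_trans[OF k4_fibre_sum[OF _ that c1]]) (use Lc[of "c ^ 4"] c4 in auto)
  have moment_root: "second_moment 5 k4_root 0 N \<le> 5 * T ^ 30 * p ^ (2 * 5)" for N
    by (rule moment, rule order_trans[OF k4_root_fibre_sum[OF _ c1]]) (use Lc[of "c ^ 5"] c5 in auto)
  have p5: "p ^ 5 = 1 / T ^ 10" by (simp add: p_def power_divide flip: power_mult)
  have root: "second_moment 5 k4_root 0 N \<le> 5 * T ^ 10" for N
  proof -
    have "T ^ 30 * p ^ (2 * 5) = T ^ 30 / T ^ 20"
      by (simp add: p_def power_divide flip: power_mult)
    also have "\<dots> = T ^ 10" using T power_diff[of T 20 30] by simp
    finally have "T ^ 30 * p ^ (2 * 5) = T ^ 10" .
    with moment_root[of N] show ?thesis by simp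
  qed
  have loss_le: "p ^ (5 - l) * (a l * real b + second_moment l (k4_edge l) 0 N / (4 * a l))
      \<le> 100 * real b + T ^ 10 / 100" if l: "l < 5" for l N
  proof -
    have "second_moment l (k4_edge l) 0 N / (4 * a l) \<le> 4 * T ^ 30 * p ^ (2 * l) / (4 * a l)"
      using moment_edge[OF l] a_pos[of l] by (intro divide_right_mono) auto
    also have "\<dots> = T ^ 30 * p ^ (2 * l) / a l" by simp
    also have "T ^ 30 * p ^ (2 * l) = (T ^ 10 * p ^ l) * (T ^ 20 * p ^ l)"
      using power_add[of T 10 20] by (simp add: mult_2 power_add)
    also have "\<dots> / a l = T ^ 20 * p ^ l / 100" unfolding a_def using T p by simp
    finally have "p ^ (5 - l) * (a l * real b + second_moment l (k4_edge l) 0 N / (4 * a l))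
      \<le> p ^ (5 - l) * (a l * real b + T ^ 20 * p ^ l / 100)"
      using p by (intro mult_left_mono add_left_mono) auto
    \<comment> \<open>The powers of \<open>p\<close> combine to \<open>p ^ 5\<close>, so the loss
      bound is the same in all five stages.\<close>
    also have "\<dots> = (p ^ (5 - l) * p ^ l) * (100 * T ^ 10 * real b + T ^ 20 / 100)"
      by (simp add: a_def field_simps)
    also have "p ^ (5 - l) * p ^ l = 1 / T ^ 10"
      using l p5 by (simp flip: power_add)
    also have "1 / T ^ 10 * (100 * T ^ 10 * real b + T ^ 20 / 100) = 100 * real b + T ^ 10 / 100"
      using T power_diff[of T 10 20] by (simp add: distrib_left)
    finally show ?thesis .
  qed
  have *: "(\<Sum>l\<in>{0..<5}. p ^ (5 - l) * (a l * real b + second_moment l (k4_edge l) 0 N / (4 * a l)))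
      \<le> (\<Sum>l\<in>{0..<5::nat}. 100 * real b + T ^ 10 / 100)" for N
    by (intro sum_mono loss_le) auto
  have losses: "(\<Sum>l\<in>{0..<5}. p ^ (5 - l) * (a l * real b + second_moment l (k4_edge l) 0 N / (4 * a l)))
      \<le> 500 * real b + T ^ 10 / 20" for N
  proof -
    have "(\<Sum>l\<in>{0..<5::nat}. 100 * real b + T ^ 10 / 100) = 500 * real b + T ^ 10 / 20" by simp
    with *[of N] show ?thesis by linarith
  qed
  have mean: "(\<Sum>\<phi>\<in>quads L. mean 0 N \<phi>) = T ^ 10" for N
    using T power_diff[of T 10 20] by (simp add: mean_def card_quads real_L p5 flip: power_mult)
  \<comment> \<open>\<open>1/5 - 1/5 * 1/20 - 1/100 * 5 = 14/100\<close>, and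
    \<open>500 / 5 = 100\<close> for the coefficient of \<open>b\<close>.\<close>
  have pot: "potential 0 N \<ge> 14 / 100 * T ^ 10 - 100 * real b" for N
    using losses[of N] root[of N] unfolding potential_def mean by (simp add: power2_eq_square)
  have b: "real b \<le> T ^ 10 / 1000"
  proof -
    have "5000 * real q \<le> T\<^sup>2" using q unfolding T_def by (metis of_nat_le_iff of_nat_mult of_nat_numeral of_nat_power)
    hence "5000 * real q * T ^ 8 \<le> T\<^sup>2 * T ^ 8" using T by (intro mult_right_mono) auto
    thus ?thesis by (simp add: b_def T_def[symmetric] flip: power_add)
  qed
  have "T ^ 10 > 0" using T by simp
  have pot_gt: "potential 0 N > real b" for N
  proof -
    have "potential 0 N \<ge> 14 / 100 * T ^ 10 - 100 * real b" by (rule pot)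
    with b \<open>T ^ 10 > 0\<close> show ?thesis by linarith
  qed
  obtain h where h: "follows n s h" "length h \<le> 5 * t ^ 8"
    and pairs: "potential 0 (\<lambda>_ _. 0)
      \<le> real (card (k4_root ` {\<phi>\<in>quads L. \<forall>i<5. k4_edge i \<phi> \<in> maker_edges h}))"
    using many_closing_pairs by blast
  let ?R = "k4_root ` {\<phi>\<in>quads L. \<forall>i<5. k4_edge i \<phi> \<in> maker_edges h}"
  have "card (breaker_edges h) \<le> q * length h" by (rule follows_invariants(4)[OF h(1)])
  also have "\<dots> \<le> b" unfolding b_def using h(2) by (intro mult_left_mono) auto
  \<comment> \<open>There are more closing edges than edges of Breaker, so some closing edge is free
    or already Maker's; \<open>claim_edge\<close> handles both.\<close>
  also have "b < card ?R" using pot_gt[of "\<lambda>_ _. 0"] pairs by linarith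
  finally have "\<not> ?R \<subseteq> breaker_edges h"
    using card_mono[of "breaker_edges h" ?R] finite_subset[OF follows_invariants(2)[OF h(1)] finite_K_edges]
    by linarith
  then obtain \<phi> where \<phi>: "\<phi> \<in> quads L" "\<forall>i<5. k4_edge i \<phi> \<in> maker_edges h"
    "k4_root \<phi> \<notin> breaker_edges h" by auto
  obtain h' where h': "follows n s h'" "maker_edges h' = insert (k4_root \<phi>) (maker_edges h)"
    using claim_edge[OF h(1) k4_root_in_K_edges[OF \<phi>(1) L(2)] \<phi>(3)] by metis
  obtain K where "K \<in> K4_copies n" "K \<subseteq> insert (k4_root \<phi>) ((\<lambda>i. k4_edge i \<phi>) ` {..<5})"
    using k4_copy[OF \<phi>(1) L(2)] by blast
  moreover from this(2) \<phi>(2) h'(2) have "K \<subseteq> maker_edges h'" by auto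
  ultimately show ?thesis using h'(1) by blast
qed

lemma breaker_loses:
  assumes "t \<ge> 3" "4 * t ^ 5 \<le> n" "5000 * q \<le> t\<^sup>2"
  shows "\<exists>h. follows n s h \<and> finished n h \<and> \<not> breaker_wins n h"
proof -
  obtain h K where h: "follows n s h" and K: "K \<in> K4_copies n" "K \<subseteq> maker_edges h"
    using maker_gets_k4[OF assms] by blast
  obtain h' where h': "follows n s h'" "finished n h'" "maker_edges h \<subseteq> maker_edges h'"
    using finish_game[OF h] by blast
  have "K \<inter> breaker_edges h' = {}" using follows_invariants(3)[OF h'(1)] K(2) h'(3) by blast
  with K(1) h' show ?thesis by (auto simp: breaker_wins_def)
qed

end

section \<open>From losing strategies to the threshold biases\<close>

lemma no_winning_strategy:
  assumes R: "\<And>M B C. R M B C \<Longrightarrow> C \<subseteq> unclaimed n M B \<and> (card C \<le> q \<or> card (B \<union> C) \<le> q * card M)"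
    and "t \<ge> 3" "4 * t ^ 5 \<le> n" "5000 * q \<le> t\<^sup>2"
  shows "\<not> winning_strategy n R s"
proof
  assume win: "winning_strategy n R s"
  have legal: "R (insert e (maker_edges h)) (breaker_edges h) (s h e)"
    if "follows n s h" "e \<in> unclaimed n (maker_edges h) (breaker_edges h)" for h e
    using win that by (auto simp: winning_strategy_def legal_strategy_def)
  interpret breaker_play n q s
  proof
    fix h e assume he: "follows n s h" "e \<in> unclaimed n (maker_edges h) (breaker_edges h)"
    show "s h e \<subseteq> unclaimed n (insert e (maker_edges h)) (breaker_edges h)"
      using R legal[OF he] by blast
    assume le: "card (breaker_edges h) \<le> q * length h"
    \<comment> \<open>The first case comes from the biased rule, the second from the budget
      rule.\<close>
    consider "card (s h e) \<le> q"
      | "card (breaker_edges h \<union> s h e) \<le> q * card (insert e (maker_edges h))"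
      using R[OF legal[OF he]] by blast
    thus "card (breaker_edges h \<union> s h e) \<le> q * Suc (length h)"
    proof cases
      case 1
      have "card (breaker_edges h \<union> s h e) \<le> card (breaker_edges h) + card (s h e)"
        by (rule card_Un_le)
      with 1 le show ?thesis by simp
    next
      case 2
      have "card (insert e (maker_edges h)) \<le> Suc (length h)"
        using card_insert_le_m1[of "Suc (length h)" "maker_edges h" e] card_maker_edges_le[of h] by simp
      hence "q * card (insert e (maker_edges h)) \<le> q * Suc (length h)" by (rule mult_le_mono2)
      with 2 show ?thesis by linarith
    qed
  qed
  from breaker_loses[OF assms(2-4)] win show False by (auto simp: winning_strategy_def)
qed

text \<open>Ensures that the minima defining the thresholds are attained. The game ends after at
  most one round, and one edge of Maker cannot cover the six edges of a \<open>K4\<close>.\<close>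

lemma take_all_wins:
  assumes R: "\<And>e. R {e} {} (unclaimed n {e} {})"
  shows "\<exists>s. winning_strategy n R s"
proof -
  define s :: strategy where "s h e = unclaimed n (insert e (maker_edges h)) (breaker_edges h)" for h e
  have inv: "h = [] \<or> (\<exists>e. h = [(e, unclaimed n {e} {})])" if "follows n s h" for h
    using that
    by induction (auto simp: s_def unclaimed_def)
  have "legal_strategy n R s"
    unfolding legal_strategy_def
  proof (intro allI impI)
    fix h e assume *: "follows n s h \<and> e \<in> unclaimed n (maker_edges h) (breaker_edges h)"
    with inv[of h] have "h = []" by (auto simp: unclaimed_def)
    with * R[of e] show "R (insert e (maker_edges h)) (breaker_edges h) (s h e)"
      by (auto simp: s_def unclaimed_def)
  qed
  moreover have "breaker_wins n h" if h: "follows n s h" "finished n h" for h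
    unfolding breaker_wins_def
  proof
    fix K assume K: "K \<in> K4_copies n"
    then obtain V where V: "V \<in> nsets {..<n} 4" "K = nsets V 2" by (auto simp: K4_copies_def)
    hence "card K = 6" by (simp add: nsets_def[of _ 4] card_nsets choose_two)
    moreover have "K \<subseteq> K_edges n" using V by (auto simp: nsets_def)
    moreover have "K_edges n \<subseteq> maker_edges h \<union> breaker_edges h"
      using h(2) by (auto simp: finished_def unclaimed_def)
    moreover have "card (maker_edges h) \<le> 1"
      using inv[OF h(1)] by auto
    moreover have "finite (maker_edges h)" by (simp add: maker_edges_def)
    ultimately show "K \<inter> breaker_edges h \<noteq> {}"
    proof (intro notI)
      assume "K \<inter> breaker_edges h = {}"
      with \<open>K \<subseteq> K_edges n\<close> \<open>K_edges n \<subseteq> _\<close> have "K \<subseteq> maker_edges h" by blast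
      from card_mono[OF \<open>finite (maker_edges h)\<close> this] show False
        using \<open>card K = 6\<close> \<open>card (maker_edges h) \<le> 1\<close> by simp
    qed
  qed
  ultimately show ?thesis unfolding winning_strategy_def by blast
qed

lemma winning_strategy_biased: "\<exists>s. winning_strategy n (biased_rule n (card (K_edges n))) s"
proof (rule take_all_wins)
  fix e
  have "card (unclaimed n {e} {}) \<le> card (K_edges n)"
    by (intro card_mono) (auto simp: unclaimed_def)
  thus "biased_rule n (card (K_edges n)) {e} {} (unclaimed n {e} {})"
    by (simp add: biased_rule_def)
qed

lemma winning_strategy_budget: "\<exists>s. winning_strategy n (budget_rule n (card (K_edges n))) s"
proof (rule take_all_wins)
  fix e
  have "card (unclaimed n {e} {}) \<le> card (K_edges n)"
    by (intro card_mono) (auto simp: unclaimed_def)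
  thus "budget_rule n (card (K_edges n)) {e} {} (unclaimed n {e} {})"
    by (simp add: budget_rule_def)
qed

text \<open>Take the largest \<open>t\<close> with \<open>4 * t ^ 5 \<le> n\<close>. Since
  \<open>972 = 4 * 3 ^ 5\<close>, it is at least 3, and \<open>t\<^sup>2\<close> has the order of
  \<open>n powr (2/5)\<close>.\<close>

lemma threshold_ge:
  assumes n: "n \<ge> 972"
    and R: "\<And>M B C. R M B C \<Longrightarrow> C \<subseteq> unclaimed n M B \<and> (card C \<le> q \<or> card (B \<union> C) \<le> q * card M)"
    and win: "winning_strategy n R s"
  shows "real q \<ge> 6 * 10 powr (-6) * real n powr (2/5)"
proof (rule ccontr)
  assume neg: "\<not> ?thesis"
  define t where "t = (GREATEST t. 4 * t ^ 5 \<le> n)"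
  have bound: "\<And>k. 4 * k ^ 5 \<le> n \<Longrightarrow> k \<le> n"
  proof -
    fix k :: nat assume "4 * k ^ 5 \<le> n"
    moreover have "k \<le> k ^ 5" by (cases "k = 0") (auto intro: self_le_power)
    ultimately show "k \<le> n" by linarith
  qed
  have t: "4 * t ^ 5 \<le> n"
    unfolding t_def by (rule GreatestI_nat[where P = "\<lambda>t. 4 * t ^ 5 \<le> n" and k = 0 and b = n])
      (simp, rule bound)
  have "3 \<le> t"
    unfolding t_def by (rule Greatest_le_nat[where P = "\<lambda>t. 4 * t ^ 5 \<le> n" and b = n])
      (use n in simp, rule bound)
  have "\<not> 4 * Suc t ^ 5 \<le> n"
    using Greatest_le_nat[of "\<lambda>t. 4 * t ^ 5 \<le> n" "Suc t" n] bound unfolding t_def[symmetric]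
    by (metis not_less_eq_eq order_refl)
  \<comment> \<open>The crude bound \<open>4 * 2 ^ 5 \<le> 4 ^ 5\<close> puts a perfect fifth power
    above \<open>n\<close>, which the exponent \<open>2/5\<close> turns into a square.\<close>
  hence "n \<le> 4 * Suc t ^ 5" by linarith
  moreover have "Suc t ^ 5 \<le> (2 * t) ^ 5" using \<open>3 \<le> t\<close> by (intro power_mono) auto
  moreover have "4 * (2 * t) ^ 5 \<le> (4 * t) ^ 5" by (simp add: power_mult_distrib)
  ultimately have "n \<le> (4 * t) ^ 5" by linarith
  hence "real n \<le> real (4 * t) ^ 5" by (metis of_nat_le_iff of_nat_power)
  hence "real n powr (2/5) \<le> (real (4 * t) ^ 5) powr (2/5)" by (intro powr_mono2) auto
  also have "\<dots> = real (4 * t) powr 2"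
  proof -
    have "real (4 * t) ^ 5 = real (4 * t) powr 5" using \<open>3 \<le> t\<close> by (subst powr_numeral) auto
    thus ?thesis by (simp only: powr_powr) simp
  qed
  also have "\<dots> = 16 * real t ^ 2" using \<open>3 \<le> t\<close> by (simp add: powr_numeral power_mult_distrib)
  finally have "real n powr (2/5) \<le> 16 * real t ^ 2" .
  moreover have "(10::real) powr (-6) = 1 / 1000000" by (simp add: powr_minus_divide)
  \<comment> \<open>\<open>5000 * 6 * 16 / 10 ^ 6 = 0.48\<close>, which is below 1.\<close>
  ultimately have "5000 * real q \<le> real t ^ 2" using neg by (simp only: not_le)
  hence "5000 * q \<le> t\<^sup>2"
    by (simp flip: of_nat_le_iff[where 'a = real])
  hence "\<not> winning_strategy n R s"
    by (intro no_winning_strategy[OF _ \<open>3 \<le> t\<close> t]) (use R in blast)+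
  with win show False by blast
qed

theorem theorem1p10:
  shows "\<forall>\<^sub>F n in sequentially.
           real (q_K4 n) \<ge> 6 * 10 powr (-6) * real n powr (2/5) \<and>
           real (q_K4_budget n) \<ge> 6 * 10 powr (-6) * real n powr (2/5)"
  using eventually_ge_at_top[of 972]
proof eventually_elim
  case (elim n)
  \<comment> \<open>As the minimum is attained, Breaker wins at the threshold itself, and
    \<open>threshold_ge\<close> can be applied with that value as \<open>q\<close>.\<close>
  have "\<exists>s. winning_strategy n (biased_rule n (q_K4 n)) s"
    unfolding q_K4_def by (rule LeastI[where P = "\<lambda>q. \<exists>s. winning_strategy n (biased_rule n q) s"])
      (rule winning_strategy_biased)
  then obtain s where s: "winning_strategy n (biased_rule n (q_K4 n)) s" ..
  have "\<exists>s. winning_strategy n (budget_rule n (q_K4_budget n)) s"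
    unfolding q_K4_budget_def by (rule LeastI[where P = "\<lambda>q. \<exists>s. winning_strategy n (budget_rule n q) s"])
      (rule winning_strategy_budget)
  then obtain s' where s': "winning_strategy n (budget_rule n (q_K4_budget n)) s'" ..
  show ?case
  proof
    show "real (q_K4 n) \<ge> 6 * 10 powr (-6) * real n powr (2/5)"
      by (rule threshold_ge[OF elim _ s]) (auto simp: biased_rule_def)
    show "real (q_K4_budget n) \<ge> 6 * 10 powr (-6) * real n powr (2/5)"
      by (rule threshold_ge[OF elim _ s']) (auto simp: budget_rule_def)
  qed
qed

end
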